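(* \textsc{Harmless Set} is fixed-parameter tractable when parametrised by the vertex cover number of the input graph.
   Context: \textsc{Harmless Set}: given a graph $G$, a threshold function $t\colon V(G)\to\mathbb{N}_{>0}$ and an integer $k$, decide whether there is a set $S\subseteq V(G)$ with $|S|\ge k$ such that every vertex $v\in V(G)$ has fewer than $t(v)$ neighbours in $S$. The vertex cover number of $G$ is the minimum size of a set $X\subseteq V(G)$ such that every edge of $G$ has an endpoint in $X$. *)

theory Defs
  imports "HOL-Library.Log_Nat"
begin

section \<open>Random access machines\<close>

text \<open>
  Unit-cost random access machine with natural-number registers, an unbounded memory with indirect
  addressing, addition and truncated subtraction, programmed with structured control flow.
  Since there is no multiplication or shift, after \<open>T\<close> steps all numbers have at most \<open>T\<close> bits more than
  the program constants and the input, so running times agree with those of Turing machines up to a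
  polynomial.
\<close>

type_synonym reg = nat
type_synonym state = "(reg \<Rightarrow> nat) \<times> (nat \<Rightarrow> nat)"  \<comment> \<open>register contents, memory contents\<close>

datatype com =
    Skip
  | Const reg nat
  | Add reg reg reg
  | Sub reg reg reg
  | Load reg reg
  | Store reg reg
  | Seq com com
  | IfNZ reg com com
  | WhileNZ reg com

inductive exec :: "com \<Rightarrow> state \<Rightarrow> nat \<Rightarrow> state \<Rightarrow> bool" where
  Skip: "exec Skip s 1 s"
| Const: "exec (Const x n) (r, m) 1 (r(x := n), m)"
| Add: "exec (Add x y z) (r, m) 1 (r(x := r y + r z), m)"
| Sub: "exec (Sub x y z) (r, m) 1 (r(x := r y - r z), m)"
| Load: "exec (Load x y) (r, m) 1 (r(x := m (r y)), m)"
| Store: "exec (Store x y) (r, m) 1 (r, m(r x := r y))"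
| Seq: "exec c1 s1 t1 s2 \<Longrightarrow> exec c2 s2 t2 s3 \<Longrightarrow> exec (Seq c1 c2) s1 (t1 + t2) s3"
| IfTrue: "fst s x \<noteq> 0 \<Longrightarrow> exec c1 s t s' \<Longrightarrow> exec (IfNZ x c1 c2) s (Suc t) s'"
| IfFalse: "fst s x = 0 \<Longrightarrow> exec c2 s t s' \<Longrightarrow> exec (IfNZ x c1 c2) s (Suc t) s'"
| WhileFalse: "fst s x = 0 \<Longrightarrow> exec (WhileNZ x c) s 1 s"
| WhileTrue: "fst s1 x \<noteq> 0 \<Longrightarrow> exec c s1 t1 s2 \<Longrightarrow> exec (WhileNZ x c) s2 t2 s3 \<Longrightarrow>
    exec (WhileNZ x c) s1 (Suc (t1 + t2)) s3"

inductive_cases Seq_elim: "exec (Seq c1 c2) s t s'"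
inductive_cases If_elim: "exec (IfNZ x c1 c2) s t s'"
inductive_cases While_elim: "exec (WhileNZ x c) s t s'"

lemma exec_deterministic:
  "exec c s t s' \<Longrightarrow> exec c s u s'' \<Longrightarrow> u = t \<and> s'' = s'"
proof (induction arbitrary: u s'' rule: exec.induct)
  case (Seq c1 s1 t1 s2 c2 t2 s3)
  from Seq.prems show ?case
    by (rule Seq_elim) (metis Seq.IH)
next
  case (IfTrue s x c1 t s' c2)
  from IfTrue.prems show ?case
    by (rule If_elim) (use IfTrue.hyps(1) in \<open>auto dest!: IfTrue.IH\<close>)
next
  case (IfFalse s x c2 t s' c1)
  from IfFalse.prems show ?case
    by (rule If_elim) (use IfFalse.hyps(1) in \<open>auto dest!: IfFalse.IH\<close>)
next
  case (WhileFalse s x c)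
  from WhileFalse.prems show ?case
    by (rule While_elim) (use WhileFalse.hyps in auto)
next
  case (WhileTrue s1 x c t1 s2 t2 s3)
  from WhileTrue.prems show ?case
    by (rule While_elim) (use WhileTrue.hyps(1) in simp, metis WhileTrue.IH)
qed (erule exec.cases; simp)+

text \<open>The input occupies the first memory cells; register 0 holds its length initially and the
  output finally.\<close>

definition init :: "nat list \<Rightarrow> state" where
  "init xs = ((\<lambda>_. 0)(0 := length xs), (\<lambda>i. if i < length xs then xs ! i else 0))"

definition result :: "state \<Rightarrow> nat" where
  "result s = fst s 0"

definition computable :: "(nat \<Rightarrow> nat) \<Rightarrow> bool" where
  "computable f \<longleftrightarrow> (\<exists>P. \<forall>n. \<exists>t s. exec P (init [n]) t s \<and> result s = f n)"


section \<open>Fixed-parameter tractability\<close>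

text \<open>Length in bits: every number contributes its binary digits and one separator.\<close>

definition input_size :: "nat list \<Rightarrow> nat" where
  "input_size xs = (\<Sum>w\<leftarrow>xs. floorlog 2 w + 1)"

text \<open>The problem with instance set \<open>I\<close>, encoding \<open>enc\<close>, yes-instances \<open>Q\<close> and parameter \<open>\<kappa>\<close>. The
  parameter value is not part of the input of the algorithm.\<close>

definition fixed_parameter_tractable ::
    "'i set \<Rightarrow> ('i \<Rightarrow> nat list) \<Rightarrow> ('i \<Rightarrow> bool) \<Rightarrow> ('i \<Rightarrow> nat) \<Rightarrow> bool" where
  "fixed_parameter_tractable I enc Q \<kappa> \<longleftrightarrow>
     (\<exists>P f c. computable f \<and>
        (\<forall>x\<in>I. \<exists>t s. exec P (init (enc x)) t s \<and>
           t \<le> f (\<kappa> x) * input_size (enc x) ^ c \<and>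
           result s = (if Q x then 1 else 0)))"


section \<open>Graphs\<close>

definition simple_graph :: "'a set \<Rightarrow> 'a set set \<Rightarrow> bool" where
  "simple_graph V E \<longleftrightarrow> finite V \<and> (\<forall>e\<in>E. e \<subseteq> V \<and> card e = 2)"

definition neighbours :: "'a set set \<Rightarrow> 'a \<Rightarrow> 'a set" where
  "neighbours E v = {u. {u, v} \<in> E}"

definition vertex_cover :: "'a set \<Rightarrow> 'a set set \<Rightarrow> 'a set \<Rightarrow> bool" where
  "vertex_cover V E X \<longleftrightarrow> X \<subseteq> V \<and> (\<forall>e\<in>E. \<exists>x\<in>e. x \<in> X)"

definition vertex_cover_number :: "'a set \<Rightarrow> 'a set set \<Rightarrow> nat" where
  "vertex_cover_number V E = Min {card X | X. vertex_cover V E X}"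

definition harmless_set :: "'a set \<Rightarrow> 'a set set \<Rightarrow> ('a \<Rightarrow> nat) \<Rightarrow> 'a set \<Rightarrow> bool" where
  "harmless_set V E t S \<longleftrightarrow> S \<subseteq> V \<and> (\<forall>v\<in>V. card (neighbours E v \<inter> S) < t v)"


section \<open>The problem Harmless Set\<close>

text \<open>As inputs of an algorithm, graphs have vertex set \<open>{..<n}\<close>.\<close>

record hs_instance =
  num_verts :: nat
  edges :: "nat set set"
  threshold :: "nat \<Rightarrow> nat"
  target :: int

abbreviation verts :: "hs_instance \<Rightarrow> nat set" where
  "verts x \<equiv> {..<num_verts x}"

definition hs_instances :: "hs_instance set" where
  "hs_instances = {x. simple_graph (verts x) (edges x) \<and> (\<forall>v\<in>verts x. threshold x v > 0)}"

definition hs_yes :: "hs_instance \<Rightarrow> bool" where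
  "hs_yes x \<longleftrightarrow>
     (\<exists>S. harmless_set (verts x) (edges x) (threshold x) S \<and> int (card S) \<ge> target x)"

definition hs_vertex_cover_number :: "hs_instance \<Rightarrow> nat" where
  "hs_vertex_cover_number x = vertex_cover_number (verts x) (edges x)"

text \<open>Number of vertices, sign and absolute value of the target, thresholds, and the rows of the
  adjacency matrix.\<close>

definition hs_encode :: "hs_instance \<Rightarrow> nat list" where
  "hs_encode x =
     [num_verts x, (if target x < 0 then 1 else 0), nat \<bar>target x\<bar>]
     @ map (threshold x) [0..<num_verts x]
     @ concat (map (\<lambda>u. map (\<lambda>v. if {u, v} \<in> edges x then 1 else 0) [0..<num_verts x])
                 [0..<num_verts x])"

end

theory Submission
  imports Defs
begin

text \<open>
  Vertices with equal neighbourhoods are interchangeable, and a graph with vertex cover number \<open>k\<close>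
  has at most \<open>p = k + 2 ^ k\<close> classes of such twins. A harmless set is determined, up to exchanging
  twins, by the numbers \<open>s\<^sub>c\<close> of vertices it takes from each class \<open>c\<close>, which are subject to
  \<open>s\<^sub>c \<le> |c|\<close> and, for every class \<open>d\<close>, to an upper bound on the sum of \<open>s\<^sub>c\<close> over the classes \<open>c\<close>
  adjacent to \<open>d\<close>. So no vertex cover has to be found: one maximises \<open>\<Sum>s\<close> subject to \<open>A s \<le> b\<close>,
  where \<open>A\<close> is a 0-1 matrix with \<open>2 p\<close> rows and \<open>p\<close> columns and \<open>b\<close> is bounded by the number of
  vertices.

  Such a program is solved bit by bit. Let \<open>F\<^sub>i(\<delta>)\<close> be the maximum of \<open>\<Sum>s\<close> subject to
  \<open>A s + \<delta> \<le> b div 2^i\<close>. Writing \<open>s = 2 s' + r\<close> with \<open>r\<close> a 0-1 vector reduces level \<open>i\<close> to level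
  \<open>i + 1\<close>, with \<open>\<delta>\<close> replaced by \<open>(\<delta> + A r)/2\<close> up to rounding. As \<open>A r\<close> has entries at most \<open>p\<close>, only
  \<open>\<delta>\<close> with entries at most \<open>p\<close> occur on any level, so the size of the table depends on \<open>p\<close> only.
\<close>

section \<open>Time-bounded program logic\<close>

text \<open>\<open>wp Z c Q s\<close> demands that \<open>c\<close>, started in \<open>s\<close>, ends in a state satisfying \<open>Q\<close> and that no
  execution of one of its loops takes more than \<open>Z\<close> iterations; the running time is then polynomial
  in \<open>Z\<close> with coefficients depending on \<open>c\<close> only.\<close>

primrec wp :: "nat \<Rightarrow> com \<Rightarrow> (state \<Rightarrow> bool) \<Rightarrow> state \<Rightarrow> bool" where
  "wp Z Skip Q = Q"
| "wp Z (Const x n) Q = (\<lambda>s. Q ((fst s)(x := n), snd s))"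
| "wp Z (Add x y z) Q = (\<lambda>s. Q ((fst s)(x := fst s y + fst s z), snd s))"
| "wp Z (Sub x y z) Q = (\<lambda>s. Q ((fst s)(x := fst s y - fst s z), snd s))"
| "wp Z (Load x y) Q = (\<lambda>s. Q ((fst s)(x := snd s (fst s y)), snd s))"
| "wp Z (Store x y) Q = (\<lambda>s. Q (fst s, (snd s)(fst s x := fst s y)))"
| "wp Z (Seq a b) Q = wp Z a (wp Z b Q)"
| "wp Z (IfNZ x a b) Q = (\<lambda>s. (if fst s x \<noteq> 0 then wp Z a Q s else wp Z b Q s))"
| "wp Z (WhileNZ x c) Q = (\<lambda>s.
     (\<exists>k\<le>Z. ((\<lambda>R s. fst s x \<noteq> 0 \<and> wp Z c R s) ^^ k) (\<lambda>s. fst s x = 0 \<and> Q s) s))"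

primrec cost_factor :: "com \<Rightarrow> nat" where
  "cost_factor Skip = 1"
| "cost_factor (Const x n) = 1"
| "cost_factor (Add x y z) = 1"
| "cost_factor (Sub x y z) = 1"
| "cost_factor (Load x y) = 1"
| "cost_factor (Store x y) = 1"
| "cost_factor (Seq a b) = cost_factor a + cost_factor b"
| "cost_factor (IfNZ x a b) = Suc (cost_factor a + cost_factor b)"
| "cost_factor (WhileNZ x c) = cost_factor c + 2"

primrec loop_depth :: "com \<Rightarrow> nat" where
  "loop_depth Skip = 0"
| "loop_depth (Const x n) = 0"
| "loop_depth (Add x y z) = 0"
| "loop_depth (Sub x y z) = 0"
| "loop_depth (Load x y) = 0"
| "loop_depth (Store x y) = 0"
| "loop_depth (Seq a b) = max (loop_depth a) (loop_depth b)"
| "loop_depth (IfNZ x a b) = max (loop_depth a) (loop_depth b)"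
| "loop_depth (WhileNZ x c) = Suc (loop_depth c)"

primrec writes :: "com \<Rightarrow> reg set" where
  "writes Skip = {}"
| "writes (Const x n) = {x}"
| "writes (Add x y z) = {x}"
| "writes (Sub x y z) = {x}"
| "writes (Load x y) = {x}"
| "writes (Store x y) = {}"
| "writes (Seq a b) = writes a \<union> writes b"
| "writes (IfNZ x a b) = writes a \<union> writes b"
| "writes (WhileNZ x c) = writes c"

primrec stores :: "com \<Rightarrow> bool" where
  "stores Skip = False"
| "stores (Const x n) = False"
| "stores (Add x y z) = False"
| "stores (Sub x y z) = False"
| "stores (Load x y) = False"
| "stores (Store x y) = True"
| "stores (Seq a b) = (stores a \<or> stores b)"
| "stores (IfNZ x a b) = (stores a \<or> stores b)"
| "stores (WhileNZ x c) = stores c"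

definition frame :: "com \<Rightarrow> state \<Rightarrow> state \<Rightarrow> bool" where
  "frame c s s' \<longleftrightarrow> (\<forall>x. x \<notin> writes c \<longrightarrow> fst s' x = fst s x) \<and> (\<not> stores c \<longrightarrow> snd s' = snd s)"

lemma frame_reg: "frame c s s' \<Longrightarrow> y \<notin> writes c \<Longrightarrow> fst s' y = fst s y"
  by (simp add: frame_def)

lemma frame_mem: "frame c s s' \<Longrightarrow> \<not> stores c \<Longrightarrow> snd s' = snd s"
  by (simp add: frame_def)

lemma frame_refl: "frame c s s"
  by (simp add: frame_def)

lemma frame_trans: "frame c s s' \<Longrightarrow> frame c s' s'' \<Longrightarrow> frame c s s''"
  by (simp add: frame_def)

lemma frame_mono:
  "frame a s s' \<Longrightarrow> writes a \<subseteq> writes b \<Longrightarrow> (stores a \<Longrightarrow> stores b) \<Longrightarrow> frame b s s'"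
  by (auto simp: frame_def)

text \<open>Strengthens a postcondition by what syntax alone guarantees about untouched registers
  and memory. Later specifications prove only the new output value and obtain the rest from
  \<open>frame\<close>.\<close>

lemma wp_frame:
  assumes "wp Z c Q s" and "\<And>s'. Q s' \<Longrightarrow> frame c s s' \<Longrightarrow> Q' s'"
  shows "wp Z c Q' s"
  using assms
proof (induction c arbitrary: Q Q' s)
  case (Seq a b)
  show ?case
    unfolding wp.simps
  proof (rule Seq.IH(1))
    show "wp Z a (wp Z b Q) s" using Seq.prems by simp
    fix s1 assume s1: "wp Z b Q s1" "frame a s s1"
    show "wp Z b Q' s1"
    proof (rule Seq.IH(2)[OF s1(1)])
      fix s2 assume s2: "Q s2" "frame b s1 s2"
      have "frame (Seq a b) s s2"
        by (rule frame_trans[of _ _ s1]) (use s1 s2 in \<open>auto elim: frame_mono\<close>)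
      then show "Q' s2" using Seq.prems s2 by blast
    qed
  qed
next
  case (IfNZ x a b)
  show ?case
  proof (cases "fst s x = 0")
    case True
    then show ?thesis
      using IfNZ.prems IfNZ.IH(2)[of Q s Q'] frame_mono[of b s _ "IfNZ x a b"] by auto
  next
    case False
    then show ?thesis
      using IfNZ.prems IfNZ.IH(1)[of Q s Q'] frame_mono[of a s _ "IfNZ x a b"] by auto
  qed
next
  case (WhileNZ x c)
  let ?F = "\<lambda>R s. fst s x \<noteq> 0 \<and> wp Z c R s"
  have "(?F ^^ k) (\<lambda>s. fst s x = 0 \<and> Q' s) s0"
    if "(?F ^^ k) (\<lambda>s. fst s x = 0 \<and> Q s) s0" "frame c s s0" for k s0
    using that
  proof (induction k arbitrary: s0)
    case 0
    then show ?case using WhileNZ.prems(2) by (simp add: frame_def)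
  next
    case (Suc k)
    then have "fst s0 x \<noteq> 0" "wp Z c ((?F ^^ k) (\<lambda>s. fst s x = 0 \<and> Q s)) s0" by auto
    moreover have "wp Z c ((?F ^^ k) (\<lambda>s. fst s x = 0 \<and> Q' s)) s0"
      by (rule WhileNZ.IH[OF calculation(2)]) (use Suc frame_trans in blast)
    ultimately show ?case by simp
  qed
  moreover obtain k where "k \<le> Z" "(?F ^^ k) (\<lambda>s. fst s x = 0 \<and> Q s) s"
    using WhileNZ.prems(1) by auto
  ultimately have "\<exists>k\<le>Z. (?F ^^ k) (\<lambda>s. fst s x = 0 \<and> Q' s) s" using frame_refl by blast
  then show ?case by simp
qed (auto simp: frame_def)

lemma wp_mono: "wp Z c Q s \<Longrightarrow> (\<And>s'. Q s' \<Longrightarrow> Q' s') \<Longrightarrow> wp Z c Q' s"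
  by (rule wp_frame)

text \<open>Induction on the program: sequencing adds coefficients, and each level of loop nesting
  contributes one factor \<open>Z\<close>. The assumption \<open>Z \<ge> 1\<close> allows exponents
  to be raised to the larger depth.\<close>

theorem wp_sound:
  assumes "wp Z c Q s" and "Z \<ge> 1"
  shows "\<exists>t s'. exec c s t s' \<and> t \<le> cost_factor c * Z ^ loop_depth c \<and> Q s'"
  using assms(1)
proof (induction c arbitrary: Q s)
  case (Seq a b)
  obtain t1 s1 where 1: "exec a s t1 s1" "t1 \<le> cost_factor a * Z ^ loop_depth a" "wp Z b Q s1"
    using Seq.IH(1)[of "wp Z b Q" s] Seq.prems by auto
  obtain t2 s2 where 2: "exec b s1 t2 s2" "t2 \<le> cost_factor b * Z ^ loop_depth b" "Q s2"
    using Seq.IH(2)[OF 1(3)] by auto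
  have "t1 + t2 \<le> cost_factor a * Z ^ max (loop_depth a) (loop_depth b)
      + cost_factor b * Z ^ max (loop_depth a) (loop_depth b)"
    using 1(2) 2(2) assms(2)
    by (intro add_mono order_trans[OF 1(2)] order_trans[OF 2(2)] mult_left_mono power_increasing) auto
  then show ?case
    using exec.Seq[OF 1(1) 2(1)] 2(3) unfolding loop_depth.simps cost_factor.simps add_mult_distrib
    by blast
next
  case (IfNZ x a b)
  let ?d = "max (loop_depth a) (loop_depth b)"
  have le: "cost_factor a * Z ^ loop_depth a \<le> cost_factor a * Z ^ ?d"
    "cost_factor b * Z ^ loop_depth b \<le> cost_factor b * Z ^ ?d" "1 \<le> Z ^ ?d"
    using assms(2) by (auto intro!: mult_left_mono power_increasing)
  show ?case
  proof (cases "fst s x = 0")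
    case True
    then obtain t s' where *: "exec b s t s'" "t \<le> cost_factor b * Z ^ loop_depth b" "Q s'"
      using IfNZ.IH(2)[of Q s] IfNZ.prems by auto
    then have "Suc t \<le> cost_factor (IfNZ x a b) * Z ^ loop_depth (IfNZ x a b)"
      using le unfolding cost_factor.simps loop_depth.simps mult_Suc add_mult_distrib by linarith
    then show ?thesis using exec.IfFalse[of s x b t s' a, OF True *(1)] *(3) by (intro exI conjI)
  next
    case False
    then obtain t s' where *: "exec a s t s'" "t \<le> cost_factor a * Z ^ loop_depth a" "Q s'"
      using IfNZ.IH(1)[of Q s] IfNZ.prems by auto
    then have "Suc t \<le> cost_factor (IfNZ x a b) * Z ^ loop_depth (IfNZ x a b)"
      using le unfolding cost_factor.simps loop_depth.simps mult_Suc add_mult_distrib by linarith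
    then show ?thesis using exec.IfTrue[of s x a t s' b, OF False *(1)] *(3) by (intro exI conjI)
  qed
next
  case (WhileNZ x c)
  let ?F = "\<lambda>R s. fst s x \<noteq> 0 \<and> wp Z c R s"
  let ?C = "cost_factor c * Z ^ loop_depth c"
  have *: "\<exists>t s'. exec (WhileNZ x c) s t s' \<and> t \<le> k * Suc ?C + 1 \<and> Q s'"
    if "(?F ^^ k) (\<lambda>s. fst s x = 0 \<and> Q s) s" for k s
    using that
  proof (induction k arbitrary: s)
    case 0
    then have "exec (WhileNZ x c) s 1 s" "Q s" using exec.WhileFalse[of s x c] by simp_all
    then show ?case by (intro exI[of _ 1] exI[of _ s]) simp
  next
    case (Suc k)
    then have nz: "fst s x \<noteq> 0" and "wp Z c ((?F ^^ k) (\<lambda>s. fst s x = 0 \<and> Q s)) s" by auto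
    then obtain t1 s1 where 1: "exec c s t1 s1" "t1 \<le> ?C" "(?F ^^ k) (\<lambda>s. fst s x = 0 \<and> Q s) s1"
      using WhileNZ.IH by blast
    obtain t2 s2 where 2: "exec (WhileNZ x c) s1 t2 s2" "t2 \<le> k * Suc ?C + 1" "Q s2"
      using Suc.IH[OF 1(3)] by blast
    have "Suc (t1 + t2) \<le> Suc k * Suc ?C + 1" using 1(2) 2(2) by simp
    then show ?case using exec.WhileTrue[OF nz 1(1) 2(1)] 2(3) by (intro exI conjI)
  qed
  from WhileNZ.prems obtain k where "k \<le> Z" "(?F ^^ k) (\<lambda>s. fst s x = 0 \<and> Q s) s" by auto
  with * obtain t s' where t: "exec (WhileNZ x c) s t s'" "t \<le> k * Suc ?C + 1" "Q s'" by blast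
  \<comment> \<open>The loop tests cost at most \<open>Z + Z\<close>. Each \<open>Z\<close> is
    absorbed by one copy of \<open>Z * Z ^ loop_depth c\<close>, which accounts for the 2 in
    \<open>cost_factor\<close>.\<close>
  have "1 \<le> Z ^ loop_depth c" using assms(2) by simp
  then have "Z \<le> Z * Z ^ loop_depth c" by simp
  moreover have "k * Suc ?C + 1 \<le> Z * Suc ?C + Z"
    using \<open>k \<le> Z\<close> assms(2) by (intro add_mono mult_right_mono) auto
  moreover have "cost_factor (WhileNZ x c) * Z ^ loop_depth (WhileNZ x c)
      = Z * ?C + Z * Z ^ loop_depth c + Z * Z ^ loop_depth c"
    by (simp add: algebra_simps)
  ultimately have "k * Suc ?C + 1 \<le> cost_factor (WhileNZ x c) * Z ^ loop_depth (WhileNZ x c)"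
    unfolding mult_Suc_right by linarith
  then have "t \<le> cost_factor (WhileNZ x c) * Z ^ loop_depth (WhileNZ x c)" using t(2) by linarith
  then show ?case using t by (intro exI conjI)
next
  case Skip
  then show ?case using exec.Skip[of s] by - (intro exI conjI, assumption, simp_all)
next
  case (Const x n)
  then show ?case using exec.Const[of x n "fst s" "snd s"] unfolding prod.collapse by - (intro exI conjI, assumption, simp_all)
next
  case (Add x y z)
  then show ?case using exec.Add[of x y z "fst s" "snd s"] unfolding prod.collapse by - (intro exI conjI, assumption, simp_all)
next
  case (Sub x y z)
  then show ?case using exec.Sub[of x y z "fst s" "snd s"] unfolding prod.collapse by - (intro exI conjI, assumption, simp_all)
next
  case (Load x y)
  then show ?case using exec.Load[of x y "fst s" "snd s"] unfolding prod.collapse by - (intro exI conjI, assumption, simp_all)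
next
  case (Store x y)
  then show ?case using exec.Store[of x y "fst s" "snd s"] unfolding prod.collapse by - (intro exI conjI, assumption, simp_all)
qed

text \<open>The index of \<open>I\<close> is the exact number of iterations still to come, so one
  family serves as invariant, termination measure and iteration count.\<close>

lemma wp_While:
  assumes "I k s" and "k \<le> Z"
    and "\<And>j s. I (Suc j) s \<Longrightarrow> fst s x \<noteq> 0 \<and> wp Z c (I j) s"
    and "\<And>s. I 0 s \<Longrightarrow> fst s x = 0 \<and> Q s"
  shows "wp Z (WhileNZ x c) Q s"
proof -
  have "((\<lambda>R s. fst s x \<noteq> 0 \<and> wp Z c R s) ^^ k) (\<lambda>s. fst s x = 0 \<and> Q s) s"
    using assms(1)
  proof (induction k arbitrary: s)
    case 0
    then show ?case using assms(4) by simp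
  next
    case (Suc k)
    then show ?case using assms(3)[OF Suc.prems] wp_mono[of Z c "I k" s] by auto
  qed
  then show ?thesis using assms(2) by auto
qed

declare wp.simps(9) [simp del]

section \<open>Counting loops and arithmetic as derived programs\<close>

abbreviation seq :: "com \<Rightarrow> com \<Rightarrow> com" (infixr ";;" 60) where
  "a ;; b \<equiv> Seq a b"

text \<open>Register 2 is scratch space for the constant 1.\<close>

definition For :: "reg \<Rightarrow> reg \<Rightarrow> reg \<Rightarrow> com \<Rightarrow> com" where
  "For c v N body = Seq (Const c 0) (Seq (Add c c N)
     (WhileNZ c (Seq (Sub v N c) (Seq body (Seq (Const 2 1) (Sub c c 2))))))"

lemma writes_For [simp]: "writes (For c v N body) = writes body \<union> {c, v, 2}"
  and stores_For [simp]: "stores (For c v N body) = stores body"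
  by (auto simp: For_def)

text \<open>The counter \<open>c\<close> runs down while \<open>v\<close> shows the ascending index.
  \<open>stable\<close> asks for an invariant blind to the registers of the loop itself;
  \<open>step\<close> may use the frame from the initial state, so facts about unwritten registers
  need not be part of \<open>I\<close>.\<close>

lemma wp_For:
  assumes N: "fst s N \<le> Z"
    and regs: "c \<notin> writes body" "N \<notin> writes body" "c \<noteq> v" "c \<noteq> N" "v \<noteq> N" "c \<noteq> 2" "N \<noteq> 2"
    and base: "I 0 s"
    and stable: "\<And>j s s'. I j s \<Longrightarrow> snd s' = snd s \<Longrightarrow>
      (\<And>x. x \<notin> {c, v, 2} \<Longrightarrow> fst s' x = fst s x) \<Longrightarrow> I j s'"
    and step: "\<And>j s'. j < fst s N \<Longrightarrow> I j s' \<Longrightarrow> fst s' v = j \<Longrightarrow> frame (For c v N body) s s' \<Longrightarrow>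
      wp Z body (I (Suc j)) s'"
    and final: "\<And>s'. I (fst s N) s' \<Longrightarrow> frame (For c v N body) s s' \<Longrightarrow> Q s'"
  shows "wp Z (For c v N body) Q s"
proof -
  \<comment> \<open>Here \<open>k\<close> counts the rounds left, so \<open>fst s N - k\<close>
    rounds are done.\<close>
  let ?J = "\<lambda>k s'. k \<le> fst s N \<and> fst s' c = k \<and> I (fst s N - k) s' \<and> frame (For c v N body) s s'"
  have "wp Z (WhileNZ c (Seq (Sub v N c) (Seq body (Seq (Const 2 1) (Sub c c 2))))) Q
     ((fst s)(c := fst s N), snd s)"
  proof (rule wp_While[where I = ?J and k = "fst s N"])
    show "?J (fst s N) ((fst s)(c := fst s N), snd s)"
      using stable[OF base] by (simp add: frame_def)
  next
    fix j s1 assume J: "?J (Suc j) s1"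
    let ?j = "fst s N - Suc j" and ?s = "((fst s1)(v := fst s1 N - fst s1 c), snd s1)"
    have "fst s1 N = fst s N" using J regs by (simp add: frame_def)
    then have v: "fst ?s v = ?j" "fst ?s c = Suc j" using J regs by auto
    have fr: "frame (For c v N body) s ?s" using J by (auto simp: frame_def)
    have "wp Z body (I (Suc ?j)) ?s"
    proof (rule step)
      show "?j < fst s N" using J by simp
      show "I ?j ?s" by (rule stable[of ?j s1]) (use J in simp_all)
    qed (fact v fr)+
    then have "wp Z body (\<lambda>s'. I (Suc ?j) s' \<and> fst s' c = Suc j \<and> frame (For c v N body) s s') ?s"
    proof (rule wp_frame)
      fix s' assume I: "I (Suc ?j) s'" and fr': "frame body ?s s'"
      from fr' have "frame (For c v N body) ?s s'" by (rule frame_mono) auto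
      then have "frame (For c v N body) s s'" by (rule frame_trans[OF fr])
      moreover have "fst s' c = fst ?s c" using fr' regs(1) unfolding frame_def by blast
      ultimately show "I (Suc ?j) s' \<and> fst s' c = Suc j \<and> frame (For c v N body) s s'"
        using I v(2) by simp
    qed
    then have "wp Z body (\<lambda>s'. ?J j ((fst s')(2 := 1, c := fst s' c - 1), snd s')) ?s"
    proof (rule wp_mono)
      fix s' assume *: "I (Suc ?j) s' \<and> fst s' c = Suc j \<and> frame (For c v N body) s s'"
      have "Suc ?j = fst s N - j" using J by (simp only: Suc_diff_Suc Suc_le_eq)
      moreover have "I (Suc ?j) ((fst s')(2 := 1, c := fst s' c - 1), snd s')"
        by (rule stable[of _ s']) (use * in simp_all)
      ultimately show "?J j ((fst s')(2 := 1, c := fst s' c - 1), snd s')"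
        using * J by (simp add: frame_def)
    qed
    then show "fst s1 c \<noteq> 0 \<and> wp Z (Seq (Sub v N c) (Seq body (Seq (Const 2 1) (Sub c c 2)))) (?J j) s1"
      using J regs by simp
  next
    fix s1 assume "?J 0 s1"
    then show "fst s1 c = 0 \<and> Q s1" using final by simp
  qed (fact N)
  then show ?thesis using regs unfolding For_def by simp
qed

definition Mul :: "reg \<Rightarrow> reg \<Rightarrow> reg \<Rightarrow> reg \<Rightarrow> reg \<Rightarrow> com" where
  "Mul d x y c v = Seq (Const d 0) (For c v y (Add d d x))"

lemma writes_Mul [simp]: "writes (Mul d x y c v) = {d, c, v, 2}"
  and stores_Mul [simp]: "\<not> stores (Mul d x y c v)"
  by (auto simp: Mul_def)

lemma wp_Mul:
  assumes "distinct [d, c, v, 2]" "x \<notin> {d, c, v, 2}" "y \<notin> {d, c, v, 2}" "fst s y \<le> Z"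
    and "\<And>s'. fst s' d = fst s x * fst s y \<Longrightarrow> frame (Mul d x y c v) s s' \<Longrightarrow> Q s'"
  shows "wp Z (Mul d x y c v) Q s"
  unfolding Mul_def wp.simps
  by (rule wp_For[where I = "\<lambda>j s'. fst s' d = fst s x * j"])
     (use assms in \<open>auto simp: frame_def intro!: assms(5)\<close>)

definition Expt :: "reg \<Rightarrow> reg \<Rightarrow> reg \<Rightarrow> reg \<Rightarrow> reg \<Rightarrow> reg \<Rightarrow> reg \<Rightarrow> reg \<Rightarrow> com" where
  "Expt d x y c v e c' v' = Seq (Const d 1) (For c v y
     (Seq (Mul e d x c' v') (Seq (Const d 0) (Add d d e))))"

lemma writes_Expt [simp]: "writes (Expt d x y c v e c' v') = {d, c, v, e, c', v', 2}"
  and stores_Expt [simp]: "\<not> stores (Expt d x y c v e c' v')"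
  by (auto simp: Expt_def)

text \<open>In each multiplication the running power is the repeated summand and \<open>x\<close>
  the loop count. So only base and exponent must be at most \<open>Z\<close>; the power itself may
  be far larger.\<close>

lemma wp_Expt:
  assumes "distinct [d, c, v, e, c', v', 2]" "x \<notin> {d, c, v, e, c', v', 2}"
    "y \<notin> {d, c, v, e, c', v', 2}" "fst s y \<le> Z" "fst s x \<le> Z"
    and "\<And>s'. fst s' d = fst s x ^ fst s y \<Longrightarrow> frame (Expt d x y c v e c' v') s s' \<Longrightarrow> Q s'"
  shows "wp Z (Expt d x y c v e c' v') Q s"
  unfolding Expt_def wp.simps
  by (rule wp_For[where I = "\<lambda>j s'. fst s' d = fst s x ^ j"])
     (use assms in \<open>auto simp: frame_def intro!: wp_Mul assms(6)\<close>)

text \<open>Repeated subtraction. The test value \<open>r + 1 - y\<close> is nonzero exactly when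
  \<open>y \<le> r\<close>, because subtraction truncates.\<close>

definition Divide :: "reg \<Rightarrow> reg \<Rightarrow> reg \<Rightarrow> reg \<Rightarrow> reg \<Rightarrow> com" where
  "Divide q r x y c = Seq (Const q 0) (Seq (Const r 0) (Seq (Add r r x)
     (Seq (Const 2 1) (Seq (Add c r 2) (Seq (Sub c c y)
     (WhileNZ c (Seq (Sub r r y) (Seq (Add q q 2) (Seq (Add c r 2) (Sub c c y))))))))))"

lemma writes_Divide [simp]: "writes (Divide q r x y c) = {q, r, c, 2}"
  and stores_Divide [simp]: "\<not> stores (Divide q r x y c)"
  by (auto simp: Divide_def)

text \<open>The number of rounds is the quotient, hence at most \<open>x\<close>; the divisor may
  exceed \<open>Z\<close>. The invariant counts the rounds left as \<open>r div y\<close>.\<close>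

lemma wp_Divide:
  assumes "distinct [q, r, c, 2]" "x \<notin> {q, r, c, 2}" "y \<notin> {q, r, c, 2}"
    and "fst s x \<le> Z" "fst s y > 0"
    and "\<And>s'. fst s' q = fst s x div fst s y \<Longrightarrow> fst s' r = fst s x mod fst s y \<Longrightarrow>
      frame (Divide q r x y c) s s' \<Longrightarrow> Q s'"
  shows "wp Z (Divide q r x y c) Q s"
proof -
  let ?W = "WhileNZ c (Seq (Sub r r y) (Seq (Add q q 2) (Seq (Add c r 2) (Sub c c y))))"
  let ?s0 = "((fst s)(q := 0, r := fst s x, 2 := 1, c := Suc (fst s x) - fst s y), snd s)"
  let ?I = "\<lambda>k s'. fst s' r div fst s y = k \<and> fst s' q * fst s y + fst s' r = fst s x \<and>
     fst s' 2 = 1 \<and> fst s' c = Suc (fst s' r) - fst s y \<and> frame (Divide q r x y c) s s'"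
  have "wp Z ?W Q ?s0"
  proof (rule wp_While[where I = ?I and k = "fst s x div fst s y"])
    show "?I (fst s x div fst s y) ?s0" using assms by (auto simp: frame_def)
    show "fst s x div fst s y \<le> Z" using assms(4) by (meson div_le_dividend le_trans)
  next
    fix j s1 assume I: "?I (Suc j) s1"
    then have ge: "fst s y \<le> fst s1 r"
      by (metis div_less nat.distinct(1) not_le)
    have y: "fst s1 y = fst s y" using I assms by (simp add: frame_def)
    have "(fst s1 r - fst s y) div fst s y = j"
      using I ge assms(5) by (simp add: le_div_geq)
    moreover have "(fst s1 q + 1) * fst s y + (fst s1 r - fst s y) = fst s x"
      using I ge by (simp add: algebra_simps)
    ultimately show "fst s1 c \<noteq> 0 \<and> wp Z (Seq (Sub r r y) (Seq (Add q q 2) (Seq (Add c r 2) (Sub c c y)))) (?I j) s1"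
      using I ge y assms by (auto simp: frame_def)
  next
    fix s1 assume I: "?I 0 s1"
    then have "fst s1 r < fst s y" using assms(5) by (simp add: div_eq_0_iff)
    moreover have "fst s x = fst s1 q * fst s y + fst s1 r" using I by simp
    ultimately have "fst s1 q = fst s x div fst s y" "fst s1 r = fst s x mod fst s y"
      by auto
    then show "fst s1 c = 0 \<and> Q s1" using I assms(6) \<open>fst s1 r < fst s y\<close> by simp
  qed
  then show ?thesis
    using assms unfolding Divide_def by simp
qed

section \<open>A digit-wise dynamic program for integer programs\<close>

lemma sum_digits_less:
  fixes \<delta> :: "nat \<Rightarrow> nat"
  assumes "\<And>h. h < m \<Longrightarrow> \<delta> h < B"
  shows "(\<Sum>h<m. \<delta> h * B ^ h) < B ^ m"
  using assms
proof (induction m)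
  case (Suc m)
  have "(\<Sum>h<m. \<delta> h * B ^ h) < B ^ m" using Suc by simp
  moreover have "\<delta> m * B ^ m + B ^ m \<le> B * B ^ m"
    using Suc.prems[of m] by (metis Suc_leI add.commute lessI mult_Suc mult_le_mono1)
  ultimately show ?case by simp
qed simp

text \<open>Splitting the sum at \<open>h\<close> leaves a lower part below \<open>B ^ h\<close>,
  which the division removes, and an upper part that is a multiple of \<open>B\<close> apart from
  the digit itself.\<close>

lemma digit_of_sum:
  fixes \<delta> :: "nat \<Rightarrow> nat"
  assumes "\<And>h. h < M \<Longrightarrow> \<delta> h < B" and "h < M"
  shows "(\<Sum>k<M. \<delta> k * B ^ k) div B ^ h mod B = \<delta> h"
proof -
  have B: "B > 0" using assms by (metis gr_zeroI not_less_zero)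
  let ?lo = "\<Sum>k<h. \<delta> k * B ^ k" and ?hi = "\<Sum>k<M - Suc h. \<delta> (Suc h + k) * B ^ k"
  have lo: "?lo < B ^ h" using assms by (intro sum_digits_less) simp
  have "(\<Sum>k<M. \<delta> k * B ^ k) = (\<Sum>k<Suc h. \<delta> k * B ^ k) + (\<Sum>k=Suc h..<M. \<delta> k * B ^ k)"
    using assms(2) sum.atLeastLessThan_concat[of 0 "Suc h" M "\<lambda>k. \<delta> k * B ^ k"]
    by (simp add: atLeast0LessThan)
  also have "(\<Sum>k=Suc h..<M. \<delta> k * B ^ k) = (\<Sum>k<M - Suc h. \<delta> (Suc h + k) * B ^ (Suc h + k))"
    using assms(2) sum.shift_bounds_nat_ivl[of "\<lambda>k. \<delta> k * B ^ k" 0 "Suc h" "M - Suc h"]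
    by (simp add: atLeast0LessThan add.commute)
  also have "\<dots> = B ^ h * (B * ?hi)"
    by (simp add: sum_distrib_left power_add mult_ac)
  finally have "(\<Sum>k<M. \<delta> k * B ^ k) = ?lo + B ^ h * (\<delta> h + B * ?hi)"
    by (simp add: algebra_simps)
  then have "(\<Sum>k<M. \<delta> k * B ^ k) div B ^ h = \<delta> h + B * ?hi"
    using lo B by (simp add: div_mult_self2)
  then show ?thesis using assms by simp
qed

text \<open>\<open>b_less\<close> makes every right-hand side vanish on level \<open>L\<close>, and
  \<open>A_ex\<close> then forces every variable to 0 there. This is the base case of the dynamic
  program.\<close>

locale carry_dp =
  fixes p M L :: nat and A :: "nat \<Rightarrow> nat \<Rightarrow> nat" and b :: "nat \<Rightarrow> nat"
  assumes A_le: "h < M \<Longrightarrow> j < p \<Longrightarrow> A h j \<le> 1"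
    and A_ex: "j < p \<Longrightarrow> \<exists>h<M. A h j = 1"
    and b_less: "h < M \<Longrightarrow> b h < 2 ^ L"
begin

text \<open>Carries entering a level are at most \<open>p\<close>, and using each of the
  \<open>p\<close> columns at most once adds at most \<open>p\<close> more. So digits up to
  \<open>2 * p\<close> must be representable.\<close>

definition base :: nat where "base = 2 * p + 1"

definition cells :: nat where "cells = base ^ M"

definition enc :: "(nat \<Rightarrow> nat) \<Rightarrow> nat" where
  "enc \<delta> = (\<Sum>h<M. \<delta> h * base ^ h)"

text \<open>Adding digit vectors is adding their codes (\<open>enc_add\<close>), so consuming column
  \<open>j\<close> is a shift of the table index by this constant.\<close>

definition col :: "nat \<Rightarrow> nat" where
  "col j = enc (\<lambda>h. A h j)"

text \<open>\<open>W\<close> is the weight of a digit of \<open>i\<close>, and \<open>\<beta>\<close> the bit of the right-hand side at that row.\<close>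

definition source :: "nat \<Rightarrow> nat \<Rightarrow> nat \<Rightarrow> nat" where
  "source W \<beta> i = (let d = i div W mod base in i - W * (d - (d + 1 - \<beta>) div 2))"

text \<open>Table entries are 0 for infeasible and one more than the optimum otherwise, so doubling an
  optimum sends \<open>t\<close> to \<open>2 * t - 1\<close>, which by truncated subtraction fixes 0.\<close>

definition halve_row :: "nat \<Rightarrow> nat \<Rightarrow> (nat \<Rightarrow> nat) \<Rightarrow> nat \<Rightarrow> nat" where
  "halve_row W \<beta> T = (\<lambda>i. if i < cells then T (source W \<beta> i) else T i)"

primrec halve :: "nat \<Rightarrow> nat \<Rightarrow> (nat \<Rightarrow> nat) \<Rightarrow> nat \<Rightarrow> nat" where
  "halve i 0 T = T"
| "halve i (Suc h) T = halve_row (base ^ h) (b h div 2 ^ i mod 2) (halve i h T)"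

definition double :: "(nat \<Rightarrow> nat) \<Rightarrow> nat \<Rightarrow> nat" where
  "double T = (\<lambda>i. if i < cells then 2 * T i - 1 else T i)"

definition use_var :: "nat \<Rightarrow> (nat \<Rightarrow> nat) \<Rightarrow> nat \<Rightarrow> nat" where
  "use_var a T = (\<lambda>i. if i < cells then max (T i) (if T (i + a) = 0 then 0 else T (i + a) + 1) else T i)"

primrec use_vars :: "nat \<Rightarrow> (nat \<Rightarrow> nat) \<Rightarrow> nat \<Rightarrow> nat" where
  "use_vars 0 T = T"
| "use_vars (Suc j) T = use_var (col j) (use_vars j T)"

definition level :: "nat \<Rightarrow> (nat \<Rightarrow> nat) \<Rightarrow> nat \<Rightarrow> nat" where
  "level i T = use_vars p (double (halve i M T))"

text \<open>Starts on level \<open>L\<close>, where only the zero carry is feasible; its optimum 0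
  is stored as 1. Stage \<open>Suc k\<close> then computes level \<open>L - 1 - k\<close>.\<close>

primrec table :: "nat \<Rightarrow> nat \<Rightarrow> nat" where
  "table 0 = (\<lambda>_. 0)(0 := 1)"
| "table (Suc k) = level (L - 1 - k) (table k)"

definition feasible :: "nat \<Rightarrow> (nat \<Rightarrow> nat) \<Rightarrow> (nat \<Rightarrow> nat) \<Rightarrow> bool" where
  "feasible i \<delta> s \<longleftrightarrow> (\<forall>h<M. (\<Sum>j<p. A h j * s j) + \<delta> h \<le> b h div 2 ^ i)"

text \<open>\<open>J\<close> marks progress within a level: variables from \<open>J\<close> on are
  still required to be even. \<open>J = 0\<close> is the doubled problem of the next level,
  \<open>J = p\<close> the unrestricted one. The predicate is downward closed in \<open>y\<close>,
  so it can be matched with \<open>y < T i\<close> for entries that store the optimum plus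
  one.\<close>

definition attains :: "nat \<Rightarrow> nat \<Rightarrow> (nat \<Rightarrow> nat) \<Rightarrow> nat \<Rightarrow> bool" where
  "attains i J \<delta> y \<longleftrightarrow>
     (\<exists>s. feasible i \<delta> s \<and> (\<forall>j. J \<le> j \<longrightarrow> j < p \<longrightarrow> even (s j)) \<and> y \<le> (\<Sum>j<p. s j))"

section \<open>Codes of carry vectors and correctness of the table\<close>

lemma less_base_iff: "d < base \<longleftrightarrow> d \<le> 2 * p"
  by (auto simp: base_def)

lemma enc_less:
  assumes "\<And>h. h < M \<Longrightarrow> \<delta> h \<le> 2 * p" shows "enc \<delta> < cells"
  unfolding enc_def cells_def by (rule sum_digits_less) (use assms less_base_iff in simp)

lemma enc_cong: "(\<And>h. h < M \<Longrightarrow> \<delta> h = \<delta>' h) \<Longrightarrow> enc \<delta> = enc \<delta>'"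
  by (simp add: enc_def)

lemma enc_add: "enc \<delta> + enc \<delta>' = enc (\<lambda>h. \<delta> h + \<delta>' h)"
  by (simp add: enc_def sum.distrib algebra_simps)

lemma enc_upd:
  assumes "h < M" "d \<le> \<delta> h"
  shows "enc (\<delta>(h := d)) = enc \<delta> - base ^ h * (\<delta> h - d)"
proof -
  have "enc \<delta>' = \<delta>' h * base ^ h + (\<Sum>k\<in>{..<M} - {h}. \<delta>' k * base ^ k)" for \<delta>'
    unfolding enc_def using assms(1) by (intro sum.remove) auto
  note this[of "\<delta>(h := d)"] this[of \<delta>]
  moreover have "(\<Sum>k\<in>{..<M} - {h}. (\<delta>(h := d)) k * base ^ k) = (\<Sum>k\<in>{..<M} - {h}. \<delta> k * base ^ k)"
    by (rule sum.cong) auto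
  moreover have "\<delta> h * base ^ h = d * base ^ h + base ^ h * (\<delta> h - d)"
    using assms(2) by (metis add_mult_distrib le_add_diff_inverse mult.commute)
  ultimately show ?thesis by simp
qed

lemma source_enc:
  assumes "\<And>h. h < M \<Longrightarrow> \<delta> h \<le> 2 * p" "h < M"
  shows "source (base ^ h) \<beta> (enc \<delta>) = enc (\<delta>(h := (\<delta> h + 1 - \<beta>) div 2))"
proof -
  have "enc \<delta> div base ^ h mod base = \<delta> h"
    unfolding enc_def by (rule digit_of_sum) (use assms less_base_iff in simp_all)
  moreover have "(\<delta> h + 1 - \<beta>) div 2 \<le> \<delta> h" by linarith
  ultimately show ?thesis using enc_upd[OF assms(2)] by (simp add: source_def Let_def)
qed

text \<open>The last row is the outermost update: reading its result at \<open>\<delta>\<close>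
  means reading the earlier stages at \<open>\<delta>\<close> with one digit replaced. Hence the
  induction varies \<open>\<delta>\<close>.\<close>

lemma halve_enc:
  assumes "m \<le> M" "\<And>h. h < M \<Longrightarrow> \<delta> h \<le> 2 * p"
  shows "halve i m T (enc \<delta>) =
    T (enc (\<lambda>h. if h < m then (\<delta> h + 1 - b h div 2 ^ i mod 2) div 2 else \<delta> h))"
  using assms
proof (induction m arbitrary: \<delta>)
  case (Suc m)
  let ?\<delta> = "\<delta>(m := (\<delta> m + 1 - b m div 2 ^ i mod 2) div 2)"
  have le: "?\<delta> h \<le> 2 * p" if "h < M" for h
  proof -
    have "(\<delta> m + 1 - b m div 2 ^ i mod 2) div 2 \<le> \<delta> m" by linarith
    then show ?thesis using Suc.prems(2)[OF that] by auto
  qed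
  have "halve i (Suc m) T (enc \<delta>) = halve i m T (enc ?\<delta>)"
    using enc_less[OF Suc.prems(2)] source_enc[OF Suc.prems(2), where h = m] Suc.prems(1)
    by (simp add: halve_row_def)
  also have "\<dots> = T (enc (\<lambda>h. if h < m then (?\<delta> h + 1 - b h div 2 ^ i mod 2) div 2 else ?\<delta> h))"
    by (rule Suc.IH) (use Suc.prems(1) le in simp_all)
  also have "(\<lambda>h. if h < m then (?\<delta> h + 1 - b h div 2 ^ i mod 2) div 2 else ?\<delta> h) =
      (\<lambda>h. if h < Suc m then (\<delta> h + 1 - b h div 2 ^ i mod 2) div 2 else \<delta> h)"
    by (auto simp: fun_eq_iff less_Suc_eq)
  finally show ?case .
qed simp

text \<open>Solutions with all entries even at level \<open>i\<close> are the doubled solutions of level \<open>i + 1\<close>;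
  rounding the consumed capacity up loses nothing.\<close>

lemma double_halve_correct:
  assumes T: "\<And>\<delta> y. (\<And>h. h < M \<Longrightarrow> \<delta> h \<le> p) \<Longrightarrow> y < T (enc \<delta>) \<longleftrightarrow> attains (Suc i) p \<delta> y"
    and \<delta>: "\<And>h. h < M \<Longrightarrow> \<delta> h \<le> 2 * p"
  shows "y < double (halve i M T) (enc \<delta>) \<longleftrightarrow> attains i 0 \<delta> y"
proof -
  let ?\<delta> = "\<lambda>h. (\<delta> h + 1 - b h div 2 ^ i mod 2) div 2"
  have eq: "enc (\<lambda>h. if h < M then ?\<delta> h else \<delta> h) = enc ?\<delta>" by (rule enc_cong) simp
  \<comment> \<open>Halving with rounding brings digits up to \<open>2 * p\<close> back to at most
    \<open>p\<close>, so the hypothesis on the next level applies.\<close>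
  have "?\<delta> h \<le> p" if "h < M" for h using \<delta>[OF that] by linarith
  from T[OF this, where y = "(y + 1) div 2"]
  have "(y + 1) div 2 < T (enc ?\<delta>) \<longleftrightarrow> attains (Suc i) p ?\<delta> ((y + 1) div 2)" by simp
  \<comment> \<open>\<open>y < 2 * t - 1\<close> is equivalent to \<open>(y + 1) div 2 < t\<close>,
    also for the infeasible entry \<open>t = 0\<close>.\<close>
  moreover have "y < double (halve i M T) (enc \<delta>) \<longleftrightarrow> (y + 1) div 2 < T (enc ?\<delta>)"
    unfolding double_def using enc_less[OF \<delta>] halve_enc[OF order_refl \<delta>, where i = i and T = T] eq by (simp, linarith)
  moreover have "feasible (Suc i) ?\<delta> s \<longleftrightarrow> feasible i \<delta> (\<lambda>j. 2 * s j)" for s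
  proof -
    \<comment> \<open>With the low bit of the capacity available for free, half of the remaining
      carry, rounded up, must fit next to \<open>X\<close> into \<open>c div 2\<close>. This is the
      formula used in \<open>source\<close>.\<close>
    have iff: "X + (d + 1 - c mod 2) div 2 \<le> c div 2 \<longleftrightarrow> 2 * X + d \<le> c" for X d c :: nat
      by (cases "even c") (auto elim!: evenE oddE)
    have "(\<Sum>j<p. A h j * (2 * s j)) = 2 * (\<Sum>j<p. A h j * s j)" for h
      by (simp add: sum_distrib_left mult_ac)
    moreover have "b h div 2 ^ Suc i = b h div 2 ^ i div 2" for h
      unfolding power_Suc2 by (rule div_mult2_eq)
    ultimately show ?thesis unfolding feasible_def iff by (simp only: iff)
  qed
  moreover have "attains i 0 \<delta> y \<longleftrightarrow> (\<exists>s. feasible i \<delta> (\<lambda>j. 2 * s j) \<and> y \<le> 2 * (\<Sum>j<p. s j))"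
  proof
    assume "attains i 0 \<delta> y"
    then obtain s where s: "feasible i \<delta> s" "\<forall>j<p. even (s j)" "y \<le> (\<Sum>j<p. s j)"
      by (auto simp: attains_def)
    have "(\<Sum>j<p. A h j * (2 * (s j div 2))) = (\<Sum>j<p. A h j * s j)" for h
      by (rule sum.cong) (use s(2) in auto)
    moreover have "2 * (\<Sum>j<p. s j div 2) = (\<Sum>j<p. s j)"
      unfolding sum_distrib_left by (rule sum.cong) (use s(2) in auto)
    ultimately show "\<exists>s. feasible i \<delta> (\<lambda>j. 2 * s j) \<and> y \<le> 2 * (\<Sum>j<p. s j)"
      using s by (intro exI[of _ "\<lambda>j. s j div 2"]) (simp add: feasible_def)
  next
    assume "\<exists>s. feasible i \<delta> (\<lambda>j. 2 * s j) \<and> y \<le> 2 * (\<Sum>j<p. s j)"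
    then obtain s where "feasible i \<delta> (\<lambda>j. 2 * s j)" "y \<le> 2 * (\<Sum>j<p. s j)" by blast
    then show "attains i 0 \<delta> y"
      unfolding attains_def by (intro exI[of _ "\<lambda>j. 2 * s j"]) (simp add: sum_distrib_left)
  qed
  moreover have "(y + 1) div 2 \<le> X \<longleftrightarrow> y \<le> 2 * X" for X by linarith
  ultimately show ?thesis by (simp add: attains_def)
qed

text \<open>If \<open>s j\<close> is odd, removing one unit makes it even, charges column
  \<open>j\<close> to the carry and lowers the total by one. Conversely, adding a unit respects the
  remaining parity conditions, since \<open>j\<close> is no longer restricted.\<close>

lemma attains_Suc:
  assumes "j < p"
  shows "attains i (Suc j) \<delta> y \<longleftrightarrow>
    attains i j \<delta> y \<or> (\<exists>z. attains i j (\<lambda>h. \<delta> h + A h j) z \<and> y \<le> Suc z)"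
proof
  assume "attains i (Suc j) \<delta> y"
  then obtain s where s: "feasible i \<delta> s" "\<And>k. Suc j \<le> k \<Longrightarrow> k < p \<Longrightarrow> even (s k)" "y \<le> (\<Sum>j<p. s j)"
    by (auto simp: attains_def)
  show "attains i j \<delta> y \<or> (\<exists>z. attains i j (\<lambda>h. \<delta> h + A h j) z \<and> y \<le> Suc z)"
  proof (cases "even (s j)")
    case True
    then have "\<forall>k. j \<le> k \<longrightarrow> k < p \<longrightarrow> even (s k)" using s(2) by (metis le_antisym not_less_eq_eq)
    then show ?thesis using s by (auto simp: attains_def)
  next
    case False
    let ?s = "s(j := s j - 1)"
    have pos: "s j > 0" using False by (metis even_zero gr0I)
    have rem: "(\<Sum>k<p. g k) = g j + (\<Sum>k\<in>{..<p} - {j}. g k)" for g :: "nat \<Rightarrow> nat"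
      using assms by (intro sum.remove) auto
    have cong: "(\<Sum>k\<in>{..<p} - {j}. A h k * ?s k) = (\<Sum>k\<in>{..<p} - {j}. A h k * s k)"
      "(\<Sum>k\<in>{..<p} - {j}. ?s k) = (\<Sum>k\<in>{..<p} - {j}. s k)" for h
      by (auto intro!: sum.cong)
    have "A h j * s j = A h j * (s j - 1) + A h j" for h
      using pos by (cases "s j") auto
    then have "(\<Sum>k<p. A h k * ?s k) + A h j = (\<Sum>k<p. A h k * s k)" for h
      using rem[of "\<lambda>k. A h k * ?s k"] rem[of "\<lambda>k. A h k * s k"] cong(1)[of h] by simp
    then have "feasible i (\<lambda>h. \<delta> h + A h j) ?s"
      using s(1) unfolding feasible_def by (metis add.assoc add.commute)
    moreover have "\<forall>k. j \<le> k \<longrightarrow> k < p \<longrightarrow> even (?s k)" using s(2) False by auto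
    moreover have "y \<le> Suc (\<Sum>k<p. ?s k)"
      using rem[of ?s] rem[of s] cong(2) s(3) pos by simp
    ultimately show ?thesis unfolding attains_def by blast
  qed
next
  assume "attains i j \<delta> y \<or> (\<exists>z. attains i j (\<lambda>h. \<delta> h + A h j) z \<and> y \<le> Suc z)"
  then show "attains i (Suc j) \<delta> y"
  proof
    assume "attains i j \<delta> y"
    then show ?thesis unfolding attains_def using Suc_leD by blast
  next
    assume "\<exists>z. attains i j (\<lambda>h. \<delta> h + A h j) z \<and> y \<le> Suc z"
    then obtain s where s: "feasible i (\<lambda>h. \<delta> h + A h j) s" "\<forall>k. j \<le> k \<longrightarrow> k < p \<longrightarrow> even (s k)"
      "y \<le> Suc (\<Sum>j<p. s j)"
      by (auto simp: attains_def)
    let ?s = "s(j := s j + 1)"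
    have rem: "(\<Sum>k<p. g k) = g j + (\<Sum>k\<in>{..<p} - {j}. g k)" for g :: "nat \<Rightarrow> nat"
      using assms by (intro sum.remove) auto
    have cong: "(\<Sum>k\<in>{..<p} - {j}. A h k * ?s k) = (\<Sum>k\<in>{..<p} - {j}. A h k * s k)"
      "(\<Sum>k\<in>{..<p} - {j}. ?s k) = (\<Sum>k\<in>{..<p} - {j}. s k)" for h
      by (auto intro!: sum.cong)
    have "(\<Sum>k<p. A h k * ?s k) = (\<Sum>k<p. A h k * s k) + A h j" for h
      using rem[of "\<lambda>k. A h k * ?s k"] rem[of "\<lambda>k. A h k * s k"] cong(1)[of h] by simp
    then have "feasible i \<delta> ?s"
      using s(1) unfolding feasible_def by (metis add.assoc add.commute)
    moreover have "\<forall>k. Suc j \<le> k \<longrightarrow> k < p \<longrightarrow> even (?s k)" using s(2) by auto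
    moreover have "y \<le> (\<Sum>k<p. ?s k)"
      using rem[of ?s] rem[of s] cong(2) s(3) by simp
    ultimately show ?thesis unfolding attains_def by blast
  qed
qed

text \<open>Step \<open>j\<close> also reads the table at \<open>\<delta>\<close> plus column
  \<open>j\<close>, whose digits may be larger by one. The range of valid carries therefore shrinks
  with \<open>j\<close>, from \<open>2 * p\<close> down to \<open>p\<close>.\<close>

lemma use_vars_correct:
  assumes "\<And>\<delta> y. (\<And>h. h < M \<Longrightarrow> \<delta> h \<le> 2 * p) \<Longrightarrow> y < T (enc \<delta>) \<longleftrightarrow> attains i 0 \<delta> y"
    and "j \<le> p" "\<And>h. h < M \<Longrightarrow> \<delta> h \<le> 2 * p - j"
  shows "y < use_vars j T (enc \<delta>) \<longleftrightarrow> attains i j \<delta> y"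
  using assms(2,3)
proof (induction j arbitrary: \<delta> y)
  case 0
  then show ?case using assms(1) by simp
next
  case (Suc j)
  let ?T = "use_vars j T"
  have lt: "enc \<delta> < cells" by (rule enc_less) (meson Suc.prems(2) diff_le_self le_trans)
  have 1: "y < ?T (enc \<delta>) \<longleftrightarrow> attains i j \<delta> y" for y
  proof (rule Suc.IH)
    fix h assume "h < M"
    then show "\<delta> h \<le> 2 * p - j" using Suc.prems(2)[of h] by linarith
  qed (use Suc.prems in simp)
  have 2: "z < ?T (enc \<delta> + col j) \<longleftrightarrow> attains i j (\<lambda>h. \<delta> h + A h j) z" for z
    unfolding col_def enc_add
  proof (rule Suc.IH)
    fix h assume "h < M"
    then show "\<delta> h + A h j \<le> 2 * p - j"
      using Suc.prems(2)[of h] A_le[of h j] Suc.prems(1) by linarith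
  qed (use Suc.prems in simp)
  have "y < use_vars (Suc j) T (enc \<delta>) \<longleftrightarrow>
      y < ?T (enc \<delta>) \<or> (\<exists>z. z < ?T (enc \<delta> + col j) \<and> y \<le> Suc z)"
  proof -
    have "y < (if t = 0 then 0 else t + 1) \<longleftrightarrow> (\<exists>z<t. y \<le> Suc z)" for t :: nat
      by (cases t) auto
    then show ?thesis using lt by (simp add: use_var_def less_max_iff_disj)
  qed
  then show ?case unfolding 1 2 using attains_Suc Suc.prems(1) by simp
qed

text \<open>Induction from the most significant bits downwards: after \<open>k\<close> stages the
  top \<open>k\<close> of the \<open>L\<close> bits have been processed.\<close>

lemma table_correct:
  assumes "k \<le> L" "\<And>h. h < M \<Longrightarrow> \<delta> h \<le> p"
  shows "y < table k (enc \<delta>) \<longleftrightarrow> attains (L - k) p \<delta> y"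
  using assms
proof (induction k arbitrary: \<delta> y)
  case 0
  have "feasible L \<delta> s \<longleftrightarrow> (\<forall>h<M. \<delta> h = 0) \<and> (\<forall>j<p. s j = 0)" for s
  proof -
    have *: "feasible L \<delta> s \<longleftrightarrow> (\<forall>h<M. (\<forall>j\<in>{..<p}. A h j = 0 \<or> s j = 0) \<and> \<delta> h = 0)"
      using b_less by (simp add: feasible_def)
    show ?thesis
    proof
      assume "feasible L \<delta> s"
      then have h: "\<And>h j. h < M \<Longrightarrow> j < p \<Longrightarrow> A h j = 0 \<or> s j = 0" "\<forall>h<M. \<delta> h = 0"
        unfolding * by auto
      have "s j = 0" if "j < p" for j
        using A_ex[OF that] h(1)[OF _ that] by (metis zero_neq_one)
      with h(2) show "(\<forall>h<M. \<delta> h = 0) \<and> (\<forall>j<p. s j = 0)" by simp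
    qed (simp add: *)
  qed
  moreover have "enc \<delta> = 0 \<longleftrightarrow> (\<forall>h<M. \<delta> h = 0)"
    by (auto simp: enc_def base_def)
  ultimately show ?case by (auto simp: attains_def intro: exI[of _ "\<lambda>_. 0"])
next
  case (Suc k)
  have eq: "L - k = Suc (L - 1 - k)" "L - Suc k = L - 1 - k" using Suc.prems(1) by auto
  have 1: "y < double (halve (L - 1 - k) M (table k)) (enc \<delta>) \<longleftrightarrow> attains (L - 1 - k) 0 \<delta> y"
    if "\<And>h. h < M \<Longrightarrow> \<delta> h \<le> 2 * p" for \<delta> y
    by (rule double_halve_correct) (use that Suc.IH Suc.prems(1) eq(1) in auto)
  show ?case
    unfolding table.simps level_def eq(2)
    by (rule use_vars_correct) (use 1 Suc.prems(2) in auto)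
qed

theorem table_optimal:
  "y < table L 0 \<longleftrightarrow>
    (\<exists>s. (\<forall>h<M. (\<Sum>j<p. A h j * s j) \<le> b h) \<and> y \<le> (\<Sum>j<p. s j))"
  using table_correct[of L "\<lambda>_. 0" y] by (auto simp: attains_def feasible_def enc_def)

end

section \<open>Harmless sets and twin classes\<close>

lemma nth_concat_uniform:
  assumes "\<And>ys. ys \<in> set yss \<Longrightarrow> length ys = n" "i < length yss" "j < n"
  shows "concat yss ! (i * n + j) = yss ! i ! j"
  using assms
proof (induction yss arbitrary: i)
  case (Cons ys yss)
  then show ?case by (cases i) (simp_all add: nth_append)
qed simp

locale harmless_instance =
  fixes x :: hs_instance
  assumes inst: "x \<in> hs_instances"
begin

abbreviation n :: nat where "n \<equiv> num_verts x"

definition adj :: "nat \<Rightarrow> nat \<Rightarrow> nat" where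
  "adj u v = (if {u, v} \<in> edges x then 1 else 0)"

text \<open>These are false twins: as edges have two distinct ends, \<open>w = v\<close> shows that
  twins below \<open>n\<close> are never adjacent.\<close>

definition twin :: "nat \<Rightarrow> nat \<Rightarrow> bool" where
  "twin u v \<longleftrightarrow> (\<forall>w<n. adj u w = adj v w)"

definition rep :: "nat \<Rightarrow> bool" where
  "rep v \<longleftrightarrow> (\<forall>u<v. \<not> twin u v)"

definition reps :: "nat list" where
  "reps = filter rep [0..<n]"

definition p :: nat where
  "p = length reps"

definition twins :: "nat \<Rightarrow> nat set" where
  "twins v = {u. u < n \<and> twin u v}"

definition class_size :: "nat \<Rightarrow> nat" where
  "class_size v = card (twins v)"

text \<open>The strict threshold condition becomes a bound by \<open>threshold x u - 1\<close>.
  Inserting \<open>n\<close> loses nothing, since no vertex has more than \<open>n\<close>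
  neighbours, and keeps the bound small enough for \<open>n\<close> bits.\<close>

definition class_bound :: "nat \<Rightarrow> nat" where
  "class_bound v = Min (insert n ((\<lambda>u. threshold x u - 1) ` twins v))"

text \<open>Rows are interleaved: row \<open>2 * q\<close> limits the size of class
  \<open>q\<close>, row \<open>2 * q + 1\<close> the number of chosen neighbours of its
  members.\<close>

definition bnd :: "nat \<Rightarrow> nat" where
  "bnd h = (if even h then class_size (reps ! (h div 2)) else class_bound (reps ! (h div 2)))"

definition A :: "nat \<Rightarrow> nat \<Rightarrow> nat" where
  "A h j = (if even h then if h div 2 = j then 1 else 0 else adj (reps ! (h div 2)) (reps ! j))"

section \<open>The partition into twin classes\<close>

lemma adj_commute: "adj u v = adj v u"
  by (simp add: adj_def insert_commute)

lemma twin_refl: "twin u u"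
  and twin_sym: "twin u v \<Longrightarrow> twin v u"
  and twin_trans: "twin u v \<Longrightarrow> twin v w \<Longrightarrow> twin u w"
  by (auto simp: twin_def)

lemma finite_twins [simp]: "finite (twins v)"
  by (simp add: twins_def)

lemma class_size_le: "class_size v \<le> n"
  using card_mono[of "{..<n}" "twins v"] by (auto simp: class_size_def twins_def)

lemma class_bound_le: "class_bound v \<le> n"
  by (simp add: class_bound_def)

lemma reps_nth: "q < p \<Longrightarrow> reps ! q < n" "q < p \<Longrightarrow> rep (reps ! q)"
  using nth_mem[of q reps] by (auto simp: p_def reps_def)

text \<open>The position of a representative is the number of smaller ones, which lets a loop over
  vertices be read as a loop over class indices.\<close>

lemma rep_nth_rank:
  assumes "v < n" "rep v"
  shows "length (filter rep [0..<v]) < p" "reps ! length (filter rep [0..<v]) = v"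
proof -
  have "[0..<n] = [0..<v] @ v # [Suc v..<n]"
    using assms(1) by (metis le_add1 less_imp_le_nat plus_nat.add_0 upt_add_eq_append upt_conv_Cons
        le_add_diff_inverse)
  then have "reps = filter rep [0..<v] @ v # filter rep [Suc v..<n]"
    using assms(2) by (simp add: reps_def)
  then show "length (filter rep [0..<v]) < p" "reps ! length (filter rep [0..<v]) = v"
    by (simp_all add: p_def)
qed

text \<open>The least twin of \<open>u\<close> is a representative. Two representatives that are
  twins coincide, as neither can be smaller than the other.\<close>

lemma ex1_class:
  assumes "u < n" shows "\<exists>!j. j < p \<and> twin u (reps ! j)"
proof -
  let ?v = "LEAST v. twin v u"
  have v: "twin ?v u" using twin_refl by (rule LeastI)
  have "?v \<le> u" using twin_refl by (rule Least_le)
  moreover have "rep ?v"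
    unfolding rep_def using v twin_trans not_less_Least by blast
  ultimately obtain j where j: "j < p" "reps ! j = ?v"
    using rep_nth_rank[of ?v] assms by auto
  moreover have "i = j" if "i < p" "twin u (reps ! i)" for i
  proof -
    have tw: "twin (reps ! i) (reps ! j)"
      using that(2) v j(2) by (metis twin_sym twin_trans)
    then have "\<not> reps ! i < reps ! j" "\<not> reps ! j < reps ! i"
      using reps_nth(2)[OF j(1)] reps_nth(2)[OF that(1)] twin_sym by (auto simp: rep_def)
    then have "reps ! i = reps ! j" by simp
    moreover have "distinct reps" by (simp add: reps_def)
    ultimately show ?thesis using that(1) j(1) by (simp add: nth_eq_iff_index_eq p_def)
  qed
  ultimately show ?thesis using v twin_sym by metis
qed

lemma card_eq_sum_classes:
  assumes "S \<subseteq> {..<n}"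
  shows "card S = (\<Sum>j<p. card (S \<inter> twins (reps ! j)))"
proof -
  have "S = (\<Union>j\<in>{..<p}. S \<inter> twins (reps ! j))"
  proof -
    have "\<exists>j<p. u \<in> twins (reps ! j)" if "u \<in> S" for u
    proof -
      have "u < n" using that assms by auto
      from ex1_class[OF this] this show ?thesis by (auto simp: twins_def)
    qed
    then show ?thesis by blast
  qed
  also have "card \<dots> = (\<Sum>j<p. card (S \<inter> twins (reps ! j)))"
    using ex1_class by (intro card_UN_disjoint) (auto simp: twins_def)
  finally show ?thesis .
qed

text \<open>Adjacency depends only on the two classes: \<open>w\<close> is exchanged for its
  representative, then by symmetry so is \<open>u\<close>. Each class thus lies entirely inside or
  entirely outside the neighbourhood.\<close>

lemma card_neighbours:
  assumes "S \<subseteq> {..<n}" "q < p" "u \<in> twins (reps ! q)"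
  shows "card (neighbours (edges x) u \<inter> S) =
    (\<Sum>j<p. adj (reps ! q) (reps ! j) * card (S \<inter> twins (reps ! j)))"
proof -
  have "card (neighbours (edges x) u \<inter> S \<inter> twins (reps ! j)) =
      adj (reps ! q) (reps ! j) * card (S \<inter> twins (reps ! j))" if "j < p" for j
  proof -
    have "w \<in> neighbours (edges x) u \<longleftrightarrow> adj (reps ! q) (reps ! j) = 1" if "w \<in> twins (reps ! j)" for w
    proof -
      have "adj w u = adj (reps ! j) u" using that assms(3) by (simp add: twins_def twin_def)
      also have "\<dots> = adj u (reps ! j)" by (rule adj_commute)
      also have "\<dots> = adj (reps ! q) (reps ! j)"
        using assms(3) reps_nth(1)[OF \<open>j < p\<close>] by (simp add: twins_def twin_def)
      finally show ?thesis by (auto simp: neighbours_def adj_def split: if_splits)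
    qed
    then have "neighbours (edges x) u \<inter> S \<inter> twins (reps ! j) =
        (if adj (reps ! q) (reps ! j) = 1 then S \<inter> twins (reps ! j) else {})"
      by auto
    then show ?thesis by (simp add: adj_def split: if_splits)
  qed
  moreover have "neighbours (edges x) u \<inter> S \<subseteq> {..<n}" using assms(1) by auto
  ultimately show ?thesis using card_eq_sum_classes by simp
qed

lemma sum_A_even: "q < p \<Longrightarrow> (\<Sum>j<p. A (2 * q) j * s j) = s q"
  by (simp add: A_def if_distrib[of "\<lambda>c. c * _"] cong: if_cong)

lemma sum_A_odd:
  "(\<Sum>j<p. A (2 * q + 1) j * s j) = (\<Sum>j<p. adj (reps ! q) (reps ! j) * s j)"
  by (simp add: A_def)

lemma all_rows_iff: "(\<forall>h<2 * p. P h) \<longleftrightarrow> (\<forall>q<p. P (2 * q) \<and> P (2 * q + 1))" for P :: "nat \<Rightarrow> bool"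
proof
  assume *: "\<forall>q<p. P (2 * q) \<and> P (2 * q + 1)"
  show "\<forall>h<2 * p. P h"
  proof (intro allI impI)
    fix h assume "h < 2 * p"
    then have "P (2 * (h div 2)) \<and> P (2 * (h div 2) + 1)" using * by auto
    then show "P h" by (cases "even h") auto
  qed
qed auto

lemma rows_feasible_iff:
  "(\<forall>h<2 * p. (\<Sum>j<p. A h j * s j) \<le> bnd h) \<longleftrightarrow>
   (\<forall>q<p. s q \<le> class_size (reps ! q) \<and>
      (\<Sum>j<p. adj (reps ! q) (reps ! j) * s j) \<le> class_bound (reps ! q))"
  unfolding all_rows_iff by (auto simp: sum_A_even sum_A_odd[unfolded Suc_eq_plus1[symmetric]] bnd_def)

lemma threshold_pos: "v < n \<Longrightarrow> threshold x v > 0"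
  using inst by (simp add: hs_instances_def)

text \<open>A harmless set is counted class by class; conversely, any choice of the prescribed
  number of vertices from each class works, because \<open>card_neighbours\<close> sees only these
  numbers.\<close>

theorem hs_yes_iff:
  "hs_yes x \<longleftrightarrow> (\<exists>s. (\<forall>h<2 * p. (\<Sum>j<p. A h j * s j) \<le> bnd h) \<and> target x \<le> int (\<Sum>j<p. s j))"
  unfolding rows_feasible_iff
proof
  assume "hs_yes x"
  then obtain S where S: "S \<subseteq> {..<n}" "\<And>v. v < n \<Longrightarrow> card (neighbours (edges x) v \<inter> S) < threshold x v"
    "target x \<le> int (card S)"
    by (auto simp: hs_yes_def harmless_set_def)
  let ?s = "\<lambda>j. card (S \<inter> twins (reps ! j))"
  have "?s q \<le> class_size (reps ! q)" for q
    unfolding class_size_def by (rule card_mono) auto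
  moreover have "(\<Sum>j<p. adj (reps ! q) (reps ! j) * ?s j) \<le> class_bound (reps ! q)" if q: "q < p" for q
  proof -
    note eq = card_neighbours[OF S(1) q, symmetric]
    have self: "reps ! q \<in> twins (reps ! q)" using reps_nth(1)[OF q] twin_refl by (simp add: twins_def)
    have "card (neighbours (edges x) (reps ! q) \<inter> S) \<le> card {..<n}"
      using S(1) by (intro card_mono) auto
    then have "(\<Sum>j<p. adj (reps ! q) (reps ! j) * ?s j) \<le> n" unfolding eq[OF self] by simp
    moreover have "(\<Sum>j<p. adj (reps ! q) (reps ! j) * ?s j) \<le> threshold x u - 1"
      if "u \<in> twins (reps ! q)" for u
      using S(2)[of u] that unfolding eq[OF that] by (simp add: twins_def)
    ultimately show ?thesis by (simp add: class_bound_def)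
  qed
  ultimately show "\<exists>s. (\<forall>q<p. s q \<le> class_size (reps ! q) \<and>
      (\<Sum>j<p. adj (reps ! q) (reps ! j) * s j) \<le> class_bound (reps ! q)) \<and> target x \<le> int (\<Sum>j<p. s j)"
    using S(3) card_eq_sum_classes[OF S(1)] by (intro exI[of _ ?s]) auto
next
  assume "\<exists>s. (\<forall>q<p. s q \<le> class_size (reps ! q) \<and>
      (\<Sum>j<p. adj (reps ! q) (reps ! j) * s j) \<le> class_bound (reps ! q)) \<and> target x \<le> int (\<Sum>j<p. s j)"
  then obtain s where s: "\<And>q. q < p \<Longrightarrow> s q \<le> card (twins (reps ! q))"
    "\<And>q. q < p \<Longrightarrow> (\<Sum>j<p. adj (reps ! q) (reps ! j) * s j) \<le> class_bound (reps ! q)"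
    "target x \<le> int (\<Sum>j<p. s j)"
    by (auto simp: class_size_def)
  have "\<forall>q. \<exists>R. q < p \<longrightarrow> R \<subseteq> twins (reps ! q) \<and> card R = s q"
    using s(1) obtain_subset_with_card_n by metis
  then obtain R where R: "\<And>q. q < p \<Longrightarrow> R q \<subseteq> twins (reps ! q)" "\<And>q. q < p \<Longrightarrow> card (R q) = s q"
    by metis
  define S where "S = (\<Union>q<p. R q)"
  have S: "S \<subseteq> {..<n}" using R(1) by (fastforce simp: S_def twins_def)
  have "S \<inter> twins (reps ! j) = R j" if "j < p" for j
  proof -
    have "u \<in> R j" if u: "u \<in> R i" "i < p" "u \<in> twins (reps ! j)" for u i
    proof -
      have "u \<in> twins (reps ! i)" using R(1) u by blast
      then have "i = j" using u(2,3) \<open>j < p\<close> ex1_class[of u] by (auto simp: twins_def)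
      then show ?thesis using u(1) by simp
    qed
    then show ?thesis using R(1)[OF that] that by (auto simp: S_def)
  qed
  then have card: "card (S \<inter> twins (reps ! j)) = s j" if "j < p" for j using R(2) that by simp
  have "card (neighbours (edges x) v \<inter> S) < threshold x v" if v: "v < n" for v
  proof -
    obtain q where q: "q < p" "v \<in> twins (reps ! q)" using ex1_class[OF v] v by (auto simp: twins_def)
    have "card (neighbours (edges x) v \<inter> S) = (\<Sum>j<p. adj (reps ! q) (reps ! j) * s j)"
      using card_neighbours[OF S q] card by simp
    also have "\<dots> \<le> class_bound (reps ! q)" by (rule s(2)[OF q(1)])
    also have "\<dots> \<le> threshold x v - 1"
      unfolding class_bound_def by (rule Min_le) (use q in auto)
    \<comment> \<open>Positivity of the threshold is what turns the bound by
      \<open>threshold x v - 1\<close> back into a strict inequality.\<close>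
    finally show ?thesis using threshold_pos[OF v] by linarith
  qed
  moreover have "card S = (\<Sum>j<p. s j)" using card_eq_sum_classes[OF S] card by simp
  ultimately show "hs_yes x"
    using S s(3) unfolding hs_yes_def harmless_set_def by (intro exI[of _ S]) auto
qed

text \<open>Using \<open>n\<close> bit levels is generous, as the bounds are at most
  \<open>n\<close>, but still polynomial in the input.\<close>

sublocale dp: carry_dp p "2 * p" n A bnd
proof
  fix h j assume "h < 2 * p" "j < p"
  then show "A h j \<le> 1" by (simp add: A_def adj_def)
next
  fix j assume "j < p"
  then show "\<exists>h<2 * p. A h j = 1" by (intro exI[of _ "2 * j"]) (simp add: A_def)
next
  fix h assume "h < 2 * p"
  have "bnd h \<le> n" using class_size_le class_bound_le by (simp add: bnd_def)
  also have "n < 2 ^ n" by simp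
  finally show "bnd h < 2 ^ n" .
qed

text \<open>A negative target is met by the zero vector. Otherwise the strict comparison is right
  because the table entry is the optimum plus one.\<close>

theorem hs_yes_iff_table:
  "hs_yes x \<longleftrightarrow> target x < 0 \<or> nat \<bar>target x\<bar> < dp.table n 0"
proof -
  have "(\<forall>h<2 * p. (\<Sum>j<p. A h j * (\<lambda>_. 0) j) \<le> bnd h)" by simp
  then have "hs_yes x" if "target x < 0"
    unfolding hs_yes_iff using that by (intro exI[of _ "\<lambda>_. 0"]) simp
  moreover have "hs_yes x \<longleftrightarrow> nat \<bar>target x\<bar> < dp.table n 0" if "\<not> target x < 0"
    unfolding hs_yes_iff dp.table_optimal using that by (metis abs_of_nonneg nat_le_iff not_less)
  ultimately show ?thesis by blast
qed

section \<open>Bounding the number of classes by the vertex cover number\<close>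

lemma obtain_vertex_cover:
  obtains X where "X \<subseteq> {..<n}" "card X = hs_vertex_cover_number x"
    "\<And>u v. {u, v} \<in> edges x \<Longrightarrow> u \<in> X \<or> v \<in> X"
proof -
  let ?C = "{card X | X. vertex_cover (verts x) (edges x) X}"
  have "?C \<subseteq> card ` Pow {..<n}" by (auto simp: vertex_cover_def)
  then have "finite ?C" by (rule finite_subset) simp
  moreover have "vertex_cover (verts x) (edges x) {..<n}"
    unfolding vertex_cover_def
  proof (intro conjI ballI)
    fix e assume "e \<in> edges x"
    then have "e \<subseteq> {..<n}" "card e = 2" using inst by (auto simp: hs_instances_def simple_graph_def)
    then show "\<exists>x\<in>e. x \<in> {..<n}" by (metis all_not_in_conv card.empty subsetD zero_neq_numeral)
  qed simp
  then have "?C \<noteq> {}" by auto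
  ultimately have "Min ?C \<in> ?C" by (rule Min_in)
  then obtain X where "vertex_cover (verts x) (edges x) X" "card X = hs_vertex_cover_number x"
    by (auto simp: hs_vertex_cover_number_def vertex_cover_number_def)
  then show thesis by (intro that[of X]) (auto simp: vertex_cover_def)
qed

text \<open>Outside a vertex cover \<open>X\<close>, a twin class is determined by its neighbourhood, a subset of \<open>X\<close>.\<close>

lemma p_le: "p \<le> hs_vertex_cover_number x + 2 ^ hs_vertex_cover_number x"
proof -
  obtain X where X: "X \<subseteq> {..<n}" "card X = hs_vertex_cover_number x"
    "\<And>u v. {u, v} \<in> edges x \<Longrightarrow> u \<in> X \<or> v \<in> X"
    by (rule obtain_vertex_cover) blast
  have fin: "finite X" using X(1) finite_subset by blast
  let ?N = "neighbours (edges x)"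
  have "inj_on ?N (set reps - X)"
  proof (rule inj_onI)
    fix u v assume uv: "u \<in> set reps - X" "v \<in> set reps - X" "?N u = ?N v"
    then have "twin u v" by (auto simp: twin_def adj_def neighbours_def insert_commute set_eq_iff)
    moreover have "rep u" "rep v" using uv by (auto simp: reps_def)
    ultimately show "u = v" unfolding rep_def using twin_sym by (metis nat_neq_iff)
  qed
  moreover have "?N ` (set reps - X) \<subseteq> Pow X"
    using X(3) by (auto simp: neighbours_def)
  ultimately have "card (set reps - X) \<le> card (Pow X)"
    using fin by (intro card_inj_on_le) auto
  moreover have "card (set reps \<inter> X) \<le> card X" using fin by (intro card_mono) auto
  moreover have "distinct reps" by (simp add: reps_def)
  then have "p = card (set reps)" unfolding p_def by (rule distinct_card[symmetric])
  moreover have "card (set reps) = card (set reps - X) + card (set reps \<inter> X)"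
    by (metis card_Int_Diff add.commute List.finite_set)
  ultimately show ?thesis using X(2) fin by (simp add: card_Pow)
qed

section \<open>Positions and size of the encoded input\<close>

lemma length_encode: "length (hs_encode x) = 3 + n + n * n"
  by (simp add: hs_encode_def length_concat o_def sum_list_triv)

lemma encode_nth:
  "hs_encode x ! 0 = n"
  "hs_encode x ! 1 = (if target x < 0 then 1 else 0)"
  "hs_encode x ! 2 = nat \<bar>target x\<bar>"
  "v < n \<Longrightarrow> hs_encode x ! (3 + v) = threshold x v"
  by (simp_all add: hs_encode_def nth_append)

lemma encode_nth_adj:
  assumes "u < n" "v < n"
  shows "hs_encode x ! (3 + n + u * n + v) = adj u v"
proof -
  let ?M = "map (\<lambda>u. map (\<lambda>v. if {u, v} \<in> edges x then 1 else (0::nat)) [0..<n]) [0..<n]"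
  have "hs_encode x ! (3 + n + u * n + v) = concat ?M ! (u * n + v)"
    by (simp add: hs_encode_def nth_append)
  also have "\<dots> = ?M ! u ! v" by (rule nth_concat_uniform) (use assms in auto)
  finally show ?thesis using assms by (simp add: adj_def)
qed

lemma input_size_ge: "n + 1 \<le> input_size (hs_encode x)"
proof -
  have "length xs \<le> input_size xs" for xs by (induction xs) (simp_all add: input_size_def)
  from this[of "hs_encode x"] show ?thesis by (simp add: length_encode)
qed

end

section \<open>The machine program\<close>

text \<open>Registers: 0 address of the table, 3 number of vertices, 4 number of classes, 5 base, 6 table
  size, 7 power of two of the current level, 8 weight of the current row, 9 current column, 28
  current bit. The table starts right behind the input and is the only memory written to;
  representatives, class data and columns are recomputed whenever they are needed.\<close>

definition Adj :: "reg \<Rightarrow> reg \<Rightarrow> reg \<Rightarrow> com" where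
  "Adj d u v = Mul 10 u 3 11 12 ;; Add 10 10 v ;; Add 10 10 3 ;; Const 13 3 ;; Add 10 10 13 ;; Load d 10"

text \<open>The two truncated differences add up to the distance of the entries, which is 0 exactly
  when they agree.\<close>

definition Is_Twin :: "reg \<Rightarrow> reg \<Rightarrow> reg \<Rightarrow> com" where
  "Is_Twin d u v = Const d 1 ;; For 14 15 3
     (Adj 16 u 15 ;; Adj 17 v 15 ;; Sub 18 16 17 ;; Sub 16 17 16 ;; Add 16 16 18 ;;
      IfNZ 16 (Const d 0) Skip)"

definition Is_Rep :: "reg \<Rightarrow> reg \<Rightarrow> com" where
  "Is_Rep d v = Const d 1 ;; For 19 20 v (Is_Twin 21 20 v ;; IfNZ 21 (Const d 0) Skip)"

definition For_Reps :: "reg \<Rightarrow> reg \<Rightarrow> reg \<Rightarrow> com \<Rightarrow> com" where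
  "For_Reps c v e body = For c v 3 (Is_Rep e v ;; IfNZ e body Skip)"

text \<open>Register 22 counts the class. Register 23 is a running minimum that starts at
  \<open>n\<close>, the element inserted in \<open>class_bound\<close>, and is replaced when its
  truncated difference to the new value is nonzero.\<close>

definition Class_Data :: "reg \<Rightarrow> com" where
  "Class_Data v = Const 22 0 ;; Const 23 0 ;; Add 23 23 3 ;; For 24 25 3
     (Is_Twin 26 25 v ;; IfNZ 26
        (Add 22 22 26 ;; Const 2 3 ;; Add 27 25 2 ;; Load 27 27 ;; Const 2 1 ;; Sub 27 27 2 ;;
         Sub 26 23 27 ;; IfNZ 26 (Const 23 0 ;; Add 23 23 27) Skip)
        Skip)"

text \<open>The table is updated in place. In \<open>Halve_Row\<close> the cell read never has a larger address than the
  cell written, in \<open>Use_Var\<close> never a smaller one; hence the two directions of traversal.\<close>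

definition Halve_Row :: com where
  "Halve_Row = For 30 31 6
     (Sub 32 6 31 ;; Const 2 1 ;; Sub 32 32 2 ;;
      Divide 33 34 32 8 35 ;; Divide 36 37 33 5 35 ;;
      Const 2 1 ;; Add 38 37 2 ;; Sub 38 38 28 ;; Const 39 2 ;; Divide 40 41 38 39 35 ;;
      Sub 45 37 40 ;; Mul 42 8 45 43 44 ;; Sub 42 32 42 ;;
      Add 42 42 0 ;; Load 42 42 ;; Add 32 32 0 ;; Store 32 42)"

definition Double :: com where
  "Double = For 30 31 6
     (Add 32 31 0 ;; Load 33 32 ;; Add 33 33 33 ;; Const 2 1 ;; Sub 33 33 2 ;; Store 32 33)"

definition Use_Var :: com where
  "Use_Var = For 30 31 6
     (Add 32 31 0 ;; Load 33 32 ;; Add 34 32 9 ;; Load 34 34 ;;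
      IfNZ 34 (Const 2 1 ;; Add 34 34 2 ;; Sub 35 34 33 ;; IfNZ 35 (Store 32 34) Skip) Skip)"

definition Times_Base :: "reg \<Rightarrow> com" where
  "Times_Base w = Mul 57 w 5 58 59 ;; Const w 0 ;; Add w w 57"

text \<open>Register 51 holds the weight of the current row. Each class contributes an even row,
  where the entry tests equality of the two representatives, and an odd row with their
  adjacency.\<close>

definition Column :: com where
  "Column = Const 9 0 ;; Const 51 1 ;; For_Reps 52 53 54
     (Sub 55 53 50 ;; Sub 56 50 53 ;; Add 55 55 56 ;; IfNZ 55 Skip (Add 9 9 51) ;; Times_Base 51 ;;
      Adj 55 53 50 ;; IfNZ 55 (Add 9 9 51) Skip ;; Times_Base 51)"

definition Bit :: "reg \<Rightarrow> com" where
  "Bit y = Divide 60 61 y 7 62 ;; Const 63 2 ;; Divide 61 28 60 63 62"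

definition Halve :: com where
  "Halve = Const 8 1 ;; For_Reps 46 47 48
     (Class_Data 47 ;; Bit 22 ;; Halve_Row ;; Times_Base 8 ;; Bit 23 ;; Halve_Row ;; Times_Base 8)"

definition Use_Vars :: com where
  "Use_Vars = For_Reps 49 50 48 (Column ;; Use_Var)"

definition Level :: com where
  "Level = Halve ;; Double ;; Use_Vars"

definition Count_Reps :: com where
  "Count_Reps = Const 4 0 ;; For 64 65 3 (Is_Rep 66 65 ;; Add 4 4 66)"

text \<open>The cells behind the input are initially 0, so storing a single 1 creates
  \<open>table 0\<close>.\<close>

definition Setup :: com where
  "Setup = Add 67 4 4 ;; Const 2 1 ;; Add 5 67 2 ;; Expt 6 5 67 68 69 70 71 72 ;;
     Const 2 1 ;; Store 0 2"

definition Fill :: com where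
  "Fill = For 73 74 3 (Sub 75 3 74 ;; Const 2 1 ;; Sub 75 75 2 ;; Const 76 2 ;;
     Expt 7 76 75 68 69 70 71 72 ;; Level)"

text \<open>Cell 1 is the sign flag and cell 2 the absolute target. The latter plus one, minus the
  table entry, vanishes exactly when the target is below the entry.\<close>

definition Decide :: com where
  "Decide = Load 77 0 ;; Const 78 1 ;; Load 79 78 ;;
     IfNZ 79 (Const 0 1)
       (Const 78 2 ;; Load 79 78 ;; Const 2 1 ;; Add 79 79 2 ;; Sub 79 79 77 ;;
        IfNZ 79 (Const 0 0) (Const 0 1))"

definition Solve :: com where
  "Solve = Const 3 0 ;; Load 3 3 ;; Count_Reps ;; Setup ;; Fill ;; Decide"

section \<open>Registers and memory that the programs may change\<close>

lemma writes_Adj [simp]: "writes (Adj d u v) = {2, 10, 11, 12, 13, d}"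
  and stores_Adj [simp]: "\<not> stores (Adj d u v)"
  by (auto simp: Adj_def)

lemma writes_Is_Twin [simp]: "writes (Is_Twin d u v) = {2, 10, 11, 12, 13, 14, 15, 16, 17, 18, d}"
  and stores_Is_Twin [simp]: "\<not> stores (Is_Twin d u v)"
  by (auto simp: Is_Twin_def)

lemma writes_Is_Rep [simp]:
    "writes (Is_Rep d v) = {2, 10, 11, 12, 13, 14, 15, 16, 17, 18, 19, 20, 21, d}"
  and stores_Is_Rep [simp]: "\<not> stores (Is_Rep d v)"
  by (auto simp: Is_Rep_def)

lemma writes_For_Reps [simp]:
    "writes (For_Reps c v e body) =
       {2, 10, 11, 12, 13, 14, 15, 16, 17, 18, 19, 20, 21, e, c, v} \<union> writes body"
  and stores_For_Reps [simp]: "stores (For_Reps c v e body) = stores body"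
  by (auto simp: For_Reps_def)

lemma writes_Class_Data [simp]:
    "writes (Class_Data v) = {2, 10, 11, 12, 13, 14, 15, 16, 17, 18, 22, 23, 24, 25, 26, 27}"
  and stores_Class_Data [simp]: "\<not> stores (Class_Data v)"
  by (auto simp: Class_Data_def)

lemma writes_Halve_Row [simp]:
    "writes Halve_Row = {2, 30, 31, 32, 33, 34, 35, 36, 37, 38, 39, 40, 41, 42, 43, 44, 45}"
  and stores_Halve_Row [simp]: "stores Halve_Row"
  by (auto simp: Halve_Row_def)

lemma writes_Double [simp]: "writes Double = {2, 30, 31, 32, 33}"
  and stores_Double [simp]: "stores Double"
  by (auto simp: Double_def)

lemma writes_Use_Var [simp]: "writes Use_Var = {2, 30, 31, 32, 33, 34, 35}"
  and stores_Use_Var [simp]: "stores Use_Var"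
  by (auto simp: Use_Var_def)

lemma writes_Times_Base [simp]: "writes (Times_Base w) = {2, 57, 58, 59, w}"
  and stores_Times_Base [simp]: "\<not> stores (Times_Base w)"
  by (auto simp: Times_Base_def)

lemma writes_Column [simp]:
    "writes Column = {2, 9, 10, 11, 12, 13, 14, 15, 16, 17, 18, 19, 20, 21, 51, 52, 53, 54, 55, 56, 57, 58, 59}"
  and stores_Column [simp]: "\<not> stores Column"
  by (auto simp: Column_def)

lemma writes_Bit [simp]: "writes (Bit y) = {2, 28, 60, 61, 62, 63}"
  and stores_Bit [simp]: "\<not> stores (Bit y)"
  by (auto simp: Bit_def)

context harmless_instance
begin

abbreviation len :: nat where "len \<equiv> length (hs_encode x)"

text \<open>This fixes the whole memory in terms of the table, so table updates can be specified by
  equations between memories.\<close>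

definition memory :: "(nat \<Rightarrow> nat) \<Rightarrow> nat \<Rightarrow> nat" where
  "memory T = (\<lambda>i. if i < len then hs_encode x ! i else T (i - len))"

definition input :: "(nat \<Rightarrow> nat) \<Rightarrow> bool" where
  "input m \<longleftrightarrow> (\<forall>i<len. m i = hs_encode x ! i)"

lemma input_memory [simp]: "input (memory T)"
  by (simp add: input_def memory_def)

lemma memory_table [simp]: "memory T (i + len) = T i" "memory T len = T 0"
  by (simp_all add: memory_def)

lemma memory_upd [simp]: "(memory T)(i + len := a) = memory (T(i := a))"
  by (auto simp: memory_def fun_eq_iff)

text \<open>The address is summed in the order in which \<open>Adj\<close> computes it.\<close>

lemma input_adj:
  assumes "input m" "u < n" "v < n"
  shows "m (u * n + v + n + 3) = adj u v"
proof -
  have "u * n + v < n * n" using assms(2,3)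
    by (metis Suc_leI add.commute add_less_le_mono mult_Suc mult_le_mono1 order_less_le_trans
        nat_add_left_cancel_less)
  then show ?thesis
    using assms(1) encode_nth_adj[OF assms(2,3)] unfolding input_def length_encode
    by (simp add: add_ac)
qed

lemma input_nth: "input m \<Longrightarrow> i < 3 + n \<Longrightarrow> m i = hs_encode x ! i"
  by (simp add: input_def length_encode)

end

text \<open>\<open>Z\<close> has to cover the loops over vertices and over table cells,
  multiplication by \<open>base\<close>, and exponentiation with base 2.\<close>

locale harmless_machine = harmless_instance +
  fixes Z :: nat
  assumes Z: "n \<le> Z" "dp.cells \<le> Z" "dp.base \<le> Z" "2 \<le> Z"
begin

section \<open>Correctness of the programs\<close>

lemma wp_Adj:
  assumes "fst s 3 = n" "input (snd s)" "fst s u < n" "fst s v < n"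
    and "u \<notin> {2, 10, 11, 12, 13}" "v \<notin> {2, 10, 11, 12, 13}"
    and "\<And>s'. fst s' d = adj (fst s u) (fst s v) \<Longrightarrow> frame (Adj d u v) s s' \<Longrightarrow> Q s'"
  shows "wp Z (Adj d u v) Q s"
proof -
  have "wp Z (Adj d u v) (\<lambda>s'. fst s' d = adj (fst s u) (fst s v)) s"
    unfolding Adj_def wp.simps
    by (rule wp_Mul) (use assms Z in \<open>auto simp: frame_def input_adj\<close>)
  then show ?thesis by (rule wp_frame) (rule assms(7))
qed

lemma wp_Is_Twin:
  assumes "fst s 3 = n" "input (snd s)" "fst s u < n" "fst s v < n"
    and "u \<notin> {2, 10, 11, 12, 13, 14, 15, 16, 17, 18, d}"
    and "v \<notin> {2, 10, 11, 12, 13, 14, 15, 16, 17, 18, d}"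
    and "d \<notin> {2, 3, 10, 11, 12, 13, 14, 15, 16, 17, 18}"
    and "\<And>s'. fst s' d = (if twin (fst s u) (fst s v) then 1 else 0) \<Longrightarrow>
      frame (Is_Twin d u v) s s' \<Longrightarrow> Q s'"
  shows "wp Z (Is_Twin d u v) Q s"
proof -
  let ?I = "\<lambda>j s'. fst s' d = (if \<forall>w<j. adj (fst s u) w = adj (fst s v) w then 1 else 0)"
  have "wp Z (Is_Twin d u v) (\<lambda>s'. fst s' d = (if twin (fst s u) (fst s v) then 1 else 0)) s"
    unfolding Is_Twin_def wp.simps
  proof (rule wp_For[where I = ?I], goal_cases)
    case (11 j s')
    then show ?case using assms
      by (auto simp: frame_def less_Suc_eq intro!: wp_Adj)
  qed (use assms Z in \<open>auto simp: twin_def\<close>)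
  then show ?thesis by (rule wp_frame) (rule assms(8))
qed

lemma wp_Is_Rep:
  assumes "fst s 3 = n" "input (snd s)" "fst s v < n"
    and "v \<notin> {2, 10, 11, 12, 13, 14, 15, 16, 17, 18, 19, 20, 21, d}"
    and "d \<notin> {2, 3, 10, 11, 12, 13, 14, 15, 16, 17, 18, 19, 20, 21}"
    and "\<And>s'. fst s' d = (if rep (fst s v) then 1 else 0) \<Longrightarrow> frame (Is_Rep d v) s s' \<Longrightarrow> Q s'"
  shows "wp Z (Is_Rep d v) Q s"
proof -
  let ?I = "\<lambda>j s'. fst s' d = (if \<forall>u<j. \<not> twin u (fst s v) then 1 else 0)"
  have "wp Z (Is_Rep d v) (\<lambda>s'. fst s' d = (if rep (fst s v) then 1 else 0)) s"
    unfolding Is_Rep_def wp.simps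
  proof (rule wp_For[where I = ?I], goal_cases)
    case (11 j s')
    then have s': "fst s' 3 = n" "fst s' v = fst s v" "fst s' 20 = j" "input (snd s')" "j < fst s v"
      using assms(1-5) by (simp_all add: frame_def)
    show ?case
      unfolding wp.simps
    proof (rule wp_Is_Twin)
      fix s'' assume s'': "fst s'' 21 = (if twin (fst s' 20) (fst s' v) then 1 else 0)"
        "frame (Is_Twin 21 20 v) s' s''"
      then have "fst s'' d = fst s' d" using assms(5) by (simp add: frame_def)
      then show "if fst s'' 21 \<noteq> 0 then ?I (Suc j) ((fst s'')(d := 0), snd s'') else ?I (Suc j) s''"
        using s''(1) s' 11(2) by (auto simp: less_Suc_eq)
    qed (use s' assms(3,4) in simp_all)
  next
    case (10 j s1 s2)
    then show ?case using assms(5) by simp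
  qed (use assms(3-5) Z in \<open>simp_all add: rep_def\<close>)
  then show ?thesis by (rule wp_frame) (rule assms(6))
qed

text \<open>The invariant is indexed by the number of representatives met so far, so other vertices
  leave the index unchanged. \<open>stable\<close> must also tolerate the scratch registers of
  \<open>Is_Rep\<close>.\<close>

lemma wp_For_Reps:
  assumes n: "fst s 3 = n"
    and regs: "c \<notin> writes body" "3 \<notin> writes body" "distinct [c, v, e]"
      "{c, v, e} \<inter> {2, 3, 10, 11, 12, 13, 14, 15, 16, 17, 18, 19, 20, 21} = {}"
    and inp: "\<And>q s'. I q s' \<Longrightarrow> input (snd s')"
    and base: "I 0 s"
    and stable: "\<And>q s s'. I q s \<Longrightarrow> snd s' = snd s \<Longrightarrow>
      (\<And>y. y \<notin> {2, 10, 11, 12, 13, 14, 15, 16, 17, 18, 19, 20, 21, e, c, v} \<Longrightarrow> fst s' y = fst s y) \<Longrightarrow>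
      I q s'"
    and step: "\<And>q s'. q < p \<Longrightarrow> I q s' \<Longrightarrow> fst s' v = reps ! q \<Longrightarrow>
      frame (For_Reps c v e body) s s' \<Longrightarrow> wp Z body (I (Suc q)) s'"
    and final: "\<And>s'. I p s' \<Longrightarrow> frame (For_Reps c v e body) s s' \<Longrightarrow> Q s'"
  shows "wp Z (For_Reps c v e body) Q s"
proof -
  let ?r = "\<lambda>j. length (filter rep [0..<j])"
  show ?thesis
    unfolding For_Reps_def
  proof (rule wp_For[where I = "\<lambda>j. I (?r j)"], goal_cases)
    case (10 j s s')
    then show ?case by (intro stable[OF 10(1,2)]) auto
  next
    case (11 j s')
    then have fr: "frame (For_Reps c v e body) s s'" by (simp add: For_Reps_def)
    have j: "j < n" "fst s' 3 = n" using 11(1) fr n regs by (auto simp: frame_def)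
    show ?case
      unfolding wp.simps
    proof (rule wp_Is_Rep)
      fix s'' assume e: "fst s'' e = (if rep (fst s' v) then 1 else 0)" and "frame (Is_Rep e v) s' s''"
      then have v: "fst s'' v = j" and fr': "frame (For_Reps c v e body) s' s''"
        using 11(3) regs by (auto simp: frame_def)
      have I: "I (?r j) s''"
        by (rule stable[OF 11(2)]) (use \<open>frame (Is_Rep e v) s' s''\<close> in \<open>auto simp: frame_def\<close>)
      have fr'': "frame (For_Reps c v e body) s s''" using fr fr' by (rule frame_trans)
      show "if fst s'' e \<noteq> 0 then wp Z body (I (?r (Suc j))) s'' else I (?r (Suc j)) s''"
      proof (cases "rep j")
        case True
        then show ?thesis
          using step[OF _ I _ fr''] rep_nth_rank[OF j(1) True] v e 11(3) by simp
      qed (use e 11(3) I in simp)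
    qed (use regs j 11(3) inp[OF 11(2)] in auto)
  next
    case (12 s')
    then show ?case using final[of s'] n by (simp add: For_Reps_def p_def reps_def)
  qed (use n Z regs base in auto)
qed

lemma wp_Times_Base:
  assumes "fst s 5 = dp.base" "w \<notin> {2, 5, 57, 58, 59}"
    and "\<And>s'. fst s' w = fst s w * dp.base \<Longrightarrow> frame (Times_Base w) s s' \<Longrightarrow> Q s'"
  shows "wp Z (Times_Base w) Q s"
proof -
  have "wp Z (Times_Base w) (\<lambda>s'. fst s' w = fst s w * dp.base) s"
    unfolding Times_Base_def wp.simps by (rule wp_Mul) (use assms(1,2) Z in simp_all)
  then show ?thesis by (rule wp_frame) (rule assms(3))
qed

text \<open>The power \<open>2 ^ i\<close> may exceed \<open>Z\<close>, but both divisions run only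
  as often as their quotients, which are at most \<open>n\<close>.\<close>

lemma wp_Bit:
  assumes "fst s 7 = 2 ^ i" "fst s y \<le> n" "y \<notin> {2, 28, 60, 61, 62, 63}"
    and "\<And>s'. fst s' 28 = fst s y div 2 ^ i mod 2 \<Longrightarrow> frame (Bit y) s s' \<Longrightarrow> Q s'"
  shows "wp Z (Bit y) Q s"
proof -
  have le: "fst s y div 2 ^ i \<le> Z" using assms(2) Z(1) by (meson div_le_dividend le_trans)
  have "wp Z (Bit y) (\<lambda>s'. fst s' 28 = fst s y div 2 ^ i mod 2) s"
    unfolding Bit_def wp.simps
  proof (rule wp_Divide)
    fix s' :: state assume "fst s' 60 = fst s y div fst s 7"
    then have s': "fst s' 60 = fst s y div 2 ^ i" using assms(1) by simp
    show "wp Z (Divide 61 28 60 63 62) (\<lambda>s'. fst s' 28 = fst s y div 2 ^ i mod 2)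
        ((fst s')(63 := 2), snd s')"
      by (rule wp_Divide) (use s' le in simp_all)
  qed (use assms(1-3) Z in simp_all)
  then show ?thesis by (rule wp_frame) (rule assms(4))
qed

lemma wp_Class_Data:
  assumes "fst s 3 = n" "input (snd s)" "fst s 47 < n"
    and "\<And>s'. fst s' 22 = class_size (fst s 47) \<Longrightarrow> fst s' 23 = class_bound (fst s 47) \<Longrightarrow>
      frame (Class_Data 47) s s' \<Longrightarrow> Q s'"
  shows "wp Z (Class_Data 47) Q s"
proof -
  let ?C = "\<lambda>j. {u. u < j \<and> twin u (fst s 47)}"
  let ?b = "\<lambda>j. Min (insert n ((\<lambda>u. threshold x u - 1) ` ?C j))"
  let ?I = "\<lambda>j s'. fst s' 22 = card (?C j) \<and> fst s' 23 = ?b j"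
  have C: "?C (Suc j) = (if twin j (fst s 47) then insert j (?C j) else ?C j)" for j
    by (auto simp: less_Suc_eq)
  have b: "?b (Suc j) = (if twin j (fst s 47) then min (threshold x j - 1) (?b j) else ?b j)" for j
    unfolding C by (simp add: insert_commute[of n])
  have "wp Z (Class_Data 47) (\<lambda>s'. fst s' 22 = class_size (fst s 47) \<and> fst s' 23 = class_bound (fst s 47)) s"
    unfolding Class_Data_def wp.simps
  proof (rule wp_For[where I = ?I], goal_cases)
    case (11 j s')
    then have s': "fst s' 3 = n" "fst s' 47 = fst s 47" "fst s' 25 = j" "input (snd s')" "j < n"
      "snd s' (j + 3) = threshold x j"
      using assms(1-3) encode_nth(4)[of j] input_nth[of "snd s" "j + 3"]
      by (simp_all add: frame_def add.commute)
    have I: "fst s' 22 = card (?C j)" "fst s' 23 = ?b j" using 11(2) by auto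
    show ?case
      unfolding wp.simps(7)
    proof (rule wp_Is_Twin, goal_cases)
      case (8 s'')
      note r = frame_reg[OF 8(2)] frame_mem[OF 8(2)]
      have r': "fst s'' 22 = card (?C j)" "fst s'' 23 = ?b j" "fst s'' 25 = j"
        "fst s'' 26 = (if twin j (fst s 47) then 1 else 0)" "snd s'' (j + 3) = threshold x j"
        using 8(1) s' I by (simp_all add: r)
      have C': "card (?C (Suc j)) = (if twin j (fst s 47) then Suc (card (?C j)) else card (?C j))"
        unfolding C by simp
      define bj where "bj = ?b j"
      have bj: "fst s'' 23 = bj" "?b (Suc j) = (if twin j (fst s 47) then min (threshold x j - 1) bj else bj)"
        unfolding bj_def by (rule r'(2), rule b)
      define cj where "cj = card (?C j)"
      have cj: "fst s'' 22 = cj" "card (?C (Suc j)) = (if twin j (fst s 47) then Suc cj else cj)"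
        unfolding cj_def by (rule r'(1), rule C')
      show ?case
      proof (cases "twin j (fst s 47)")
        case False
        then show ?thesis unfolding cj(2) bj(2) using r'(4) cj(1) bj(1) by simp
      next
        case True
        then have tw: "fst s'' 26 = 1" using r'(4) by simp
        show ?thesis
        proof (cases "bj \<le> threshold x j - 1")
          case le: True
          then have "bj - (threshold x j - 1) = 0" "min (threshold x j - 1) bj = bj" by simp_all
          then show ?thesis
            unfolding cj(2) bj(2) if_P[OF True] by (simp add: tw r'(3,5) cj(1) bj(1))
        next
          case gt: False
          then have "bj - (threshold x j - 1) > 0" "min (threshold x j - 1) bj = threshold x j - 1"
            by simp_all
          then show ?thesis
            unfolding cj(2) bj(2) if_P[OF True] by (simp add: tw r'(3,5) cj(1) bj(1))
        qed
      qed
    qed (use s' assms(3) in simp_all)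
  qed (use assms(1-3) Z in \<open>auto simp: class_size_def class_bound_def twins_def\<close>)
  then show ?thesis by (rule wp_frame) (use assms(4) in auto)
qed

lemma wp_Halve_Row:
  assumes "fst s 0 = len" "fst s 5 = dp.base" "fst s 6 = dp.cells" "fst s 8 = W" "W > 0"
    "fst s 28 = \<beta>" "snd s = memory T"
    and "\<And>s'. snd s' = memory (dp.halve_row W \<beta> T) \<Longrightarrow> frame Halve_Row s s' \<Longrightarrow> Q s'"
  shows "wp Z Halve_Row Q s"
proof -
  \<comment> \<open>After \<open>j\<close> rounds exactly the top \<open>j\<close> cells carry new
    values.\<close>
  let ?T = "\<lambda>j i. if dp.cells - j \<le> i \<and> i < dp.cells then T (dp.source W \<beta> i) else T i"
  have "wp Z Halve_Row (\<lambda>s'. snd s' = memory (dp.halve_row W \<beta> T)) s"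
    unfolding Halve_Row_def
  proof (rule wp_For[where I = "\<lambda>j s'. snd s' = memory (?T j)"], goal_cases)
    case (11 j s')
    define i where "i = dp.cells - Suc j"
    define d where "d = i div W mod dp.base"
    define d' where "d' = (d + 1 - \<beta>) div 2"
    have s': "fst s' 0 = len" "fst s' 5 = dp.base" "fst s' 6 = dp.cells" "fst s' 8 = W"
      "fst s' 28 = \<beta>" "snd s' = memory (?T j)" "fst s' 31 = j" "j < dp.cells"
      using 11 assms(1-6) by (simp_all add: frame_def)
    have base: "dp.base > 0" by (simp add: dp.base_def)
    have i: "i < dp.cells" "i < dp.cells - j" "i \<le> Z" "i div W \<le> Z"
      using s'(8) Z(2) div_le_dividend[of i W] unfolding i_def by linarith+
    have d: "d < dp.base" "d \<le> Z" "d + 1 - \<beta> \<le> Z" "d - d' \<le> Z"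
      using base Z(3) mod_less_divisor[OF base, of "i div W"] unfolding d_def by linarith+
    have src: "dp.source W \<beta> i = i - W * (d - d')"
      by (simp add: dp.source_def d_def d'_def Let_def)
    have upd: "(?T j)(i := T (i - W * (d - d'))) = ?T (Suc j)"
      using s'(8) i unfolding src[symmetric] by (auto simp: fun_eq_iff i_def)
    \<comment> \<open>The cell read lies at or below \<open>i\<close> and has not been overwritten
      yet.\<close>
    have old: "?T j (i - W * (d - d')) = T (i - W * (d - d'))"
      using i(2) by auto
    show ?case
      unfolding wp.simps
    proof (rule wp_Divide, goal_cases)
      case (6 s1)
      have s1: "fst s1 33 = i div W" "fst s1 32 = i" "fst s1 0 = len" "fst s1 5 = dp.base" "fst s1 8 = W"
        "fst s1 28 = \<beta>" "snd s1 = memory (?T j)"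
        using 6(1) s' by (simp_all add: frame_reg[OF 6(3)] frame_mem[OF 6(3)] i_def)
      show ?case
      proof (rule wp_Divide, goal_cases)
        case (6 s2)
        have s2: "fst s2 37 = d" "fst s2 32 = i" "fst s2 0 = len" "fst s2 8 = W"
          "fst s2 28 = \<beta>" "snd s2 = memory (?T j)"
          using 6(2) s1 by (simp_all add: frame_reg[OF 6(3)] frame_mem[OF 6(3)] d_def)
        show ?case
        proof (rule wp_Divide, goal_cases)
          case (6 s3)
          have s3: "fst s3 40 = d'" "fst s3 37 = d" "fst s3 32 = i" "fst s3 0 = len" "fst s3 8 = W"
            "snd s3 = memory (?T j)"
            using 6(1) s2 by (simp_all add: frame_reg[OF 6(3)] frame_mem[OF 6(3)] d'_def)
          show ?case
          proof (rule wp_Mul, goal_cases)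
            case (5 s4)
            have s4: "fst s4 42 = W * (d - d')" "fst s4 32 = i" "fst s4 0 = len" "snd s4 = memory (?T j)"
              using 5(1) s3 by (simp_all add: frame_reg[OF 5(2)] frame_mem[OF 5(2)])
            have "(memory (?T j))(i + len := memory (?T j) (i - W * (d - d') + len)) = memory (?T (Suc j))"
              unfolding memory_table memory_upd old upd ..
            then show ?case using s4 by simp
          qed (use s3 d(4) in simp_all)
        qed (use s2 d(3) in simp_all)
      qed (use s1 i(4) base in simp_all)
    qed (use s' i assms(5) in \<open>simp_all add: i_def\<close>)
  next
    case 9
    have "?T 0 = T" by (auto simp: fun_eq_iff)
    then show ?case using assms(7) by simp
  next
    case (12 s')
    then show ?case using assms(3) by (simp add: dp.halve_row_def)
  qed (use assms(3) Z(2) in simp_all)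
  then show ?thesis by (rule wp_frame) (rule assms(8))
qed

lemma wp_Double:
  assumes "fst s 0 = len" "fst s 6 = dp.cells" "snd s = memory T"
    and "\<And>s'. snd s' = memory (dp.double T) \<Longrightarrow> frame Double s s' \<Longrightarrow> Q s'"
  shows "wp Z Double Q s"
proof -
  let ?T = "\<lambda>j i. if i < j then 2 * T i - 1 else T i"
  have "wp Z Double (\<lambda>s'. snd s' = memory (dp.double T)) s"
    unfolding Double_def
  proof (rule wp_For[where I = "\<lambda>j s'. snd s' = memory (?T j)"], goal_cases)
    case (11 j s')
    then have s': "fst s' 0 = len" "snd s' = memory (?T j)" "fst s' 31 = j"
      using assms(1) by (simp_all add: frame_def)
    have "(?T j)(j := 2 * T j - 1) = ?T (Suc j)" by (auto simp: fun_eq_iff less_Suc_eq)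
    then show ?case using s' by (simp add: mult_2)
  next
    case 9
    then show ?case using assms(3) by simp
  next
    case (12 s')
    then show ?case using assms(2) by (simp add: dp.double_def)
  qed (use assms(2) Z(2) in simp_all)
  then show ?thesis by (rule wp_frame) (rule assms(4))
qed

lemma wp_Use_Var:
  assumes "fst s 0 = len" "fst s 6 = dp.cells" "fst s 9 = a" "snd s = memory T"
    and "\<And>s'. snd s' = memory (dp.use_var a T) \<Longrightarrow> frame Use_Var s s' \<Longrightarrow> Q s'"
  shows "wp Z Use_Var Q s"
proof -
  let ?m = "\<lambda>i. max (T i) (if T (i + a) = 0 then 0 else T (i + a) + 1)"
  let ?T = "\<lambda>j i. if i < j then ?m i else T i"
  have "wp Z Use_Var (\<lambda>s'. snd s' = memory (dp.use_var a T)) s"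
    unfolding Use_Var_def
  proof (rule wp_For[where I = "\<lambda>j s'. snd s' = memory (?T j)"], goal_cases)
    case (11 j s')
    then have s': "fst s' 0 = len" "fst s' 9 = a" "snd s' = memory (?T j)" "fst s' 31 = j"
      using assms(1,3) by (simp_all add: frame_def)
    have upd: "(?T j)(j := ?m j) = ?T (Suc j)" by (auto simp: fun_eq_iff less_Suc_eq)
    \<comment> \<open>Both cells lie at or above \<open>j\<close>, where the old table is still
      intact.\<close>
    have read: "memory (?T j) (j + len) = T j" "memory (?T j) (j + len + a) = T (j + a)"
    proof -
      show "memory (?T j) (j + len) = T j" by simp
      have "j + len + a = (j + a) + len" by (simp only: add_ac)
      then show "memory (?T j) (j + len + a) = T (j + a)" by (simp only: memory_table) simp
    qed
    have keep: "memory (?T j) = memory (?T (Suc j))" if "?m j = T j"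
    proof -
      have "?T j = (?T j)(j := ?m j)" unfolding that by (rule fun_upd_idem[symmetric]) simp
      then show ?thesis unfolding upd by (rule arg_cong)
    qed
    have store: "(memory (?T j))(j + len := T (j + a) + 1) = memory (?T (Suc j))"
      if "?m j = T (j + a) + 1"
      unfolding memory_upd using upd unfolding that by (rule arg_cong)
    show ?case
    proof (cases "T (j + a) = 0")
      case True
      then show ?thesis using s' read keep by simp
    next
      case False
      show ?thesis
      proof (cases "T (j + a) + 1 \<le> T j")
        case True
        then show ?thesis using s' read keep False by simp
      next
        case False
        then show ?thesis using s' read store \<open>T (j + a) \<noteq> 0\<close> by simp
      qed
    qed
  next
    case 9
    then show ?case using assms(4) by simp
  next
    case (12 s')
    then show ?case using assms(2) by (simp add: dp.use_var_def)
  qed (use assms(2) Z(2) in simp_all)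
  then show ?thesis by (rule wp_frame) (rule assms(5))
qed

lemma reps_eq_iff: "q < p \<Longrightarrow> j < p \<Longrightarrow> reps ! q = reps ! j \<longleftrightarrow> q = j"
  by (simp add: nth_eq_iff_index_eq p_def reps_def)

lemma wp_Column:
  assumes "fst s 3 = n" "fst s 5 = dp.base" "input (snd s)" "fst s 50 = reps ! j" "j < p"
    and "\<And>s'. fst s' 9 = dp.col j \<Longrightarrow> frame Column s s' \<Longrightarrow> Q s'"
  shows "wp Z Column Q s"
proof -
  let ?S = "\<lambda>m. \<Sum>h<m. A h j * dp.base ^ h"
  let ?I = "\<lambda>q (s'::state). input (snd s') \<and> fst s' 51 = dp.base ^ (2 * q) \<and> fst s' 9 = ?S (2 * q)"
  have "wp Z Column (\<lambda>s'. fst s' 9 = dp.col j) s"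
    unfolding Column_def wp.simps
  proof (rule wp_For_Reps[where I = ?I], goal_cases)
    case (9 q s')
    then have s': "fst s' 3 = n" "fst s' 5 = dp.base" "fst s' 50 = reps ! j" "fst s' 53 = reps ! q"
      "q < p" "input (snd s')" "fst s' 51 = dp.base ^ (2 * q)" "fst s' 9 = ?S (2 * q)"
      using assms(1-4) by (simp_all add: frame_def)
    define R where "R = Times_Base 51 ;; Adj 55 53 50 ;; IfNZ 55 (Add 9 9 51) Skip ;; Times_Base 51"
    define J where "J = ?I (Suc q)"
    have rest: "wp Z R J s1"
      if s1: "fst s1 3 = n" "fst s1 5 = dp.base" "fst s1 50 = reps ! j" "fst s1 53 = reps ! q"
        "input (snd s1)" "fst s1 51 = dp.base ^ (2 * q)" "fst s1 9 = ?S (2 * q + 1)" for s1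
      unfolding R_def J_def wp.simps(7)
    proof (rule wp_Times_Base, goal_cases)
      case (3 s2)
      have s2: "fst s2 3 = n" "fst s2 5 = dp.base" "fst s2 50 = reps ! j" "fst s2 53 = reps ! q"
        "input (snd s2)" "fst s2 51 = dp.base ^ (2 * q + 1)" "fst s2 9 = ?S (2 * q + 1)"
        using 3(1) s1 by (simp_all add: frame_reg[OF 3(2)] frame_mem[OF 3(2)])
      show ?case
      proof (rule wp_Adj, goal_cases)
        case (7 s3)
        have s3: "fst s3 5 = dp.base" "fst s3 55 = A (2 * q + 1) j"
          "input (snd s3)" "fst s3 51 = dp.base ^ (2 * q + 1)" "fst s3 9 = ?S (2 * q + 1)"
          using 7(1) s2 by (simp_all add: frame_reg[OF 7(2)] frame_mem[OF 7(2)] A_def)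
        have last: "wp Z (Times_Base 51) (?I (Suc q)) s4"
          if s4: "fst s4 5 = dp.base" "input (snd s4)" "fst s4 51 = dp.base ^ (2 * q + 1)"
            "fst s4 9 = ?S (2 * Suc q)" for s4
        proof (rule wp_Times_Base, goal_cases)
          case (3 s5)
          then show ?case using s4 by (simp add: frame_reg[OF 3(2)] frame_mem[OF 3(2)])
        qed (use s4 in simp_all)
        have "A (2 * q + 1) j = 0 \<or> A (2 * q + 1) j = 1" by (simp add: A_def adj_def)
        then show ?case
          unfolding J_def[symmetric]
        proof
          assume "A (2 * q + 1) j = 0"
          then show "wp Z (IfNZ 55 (Add 9 9 51) Skip) (wp Z (Times_Base 51) J) s3"
            using s3 by (simp add: last[folded J_def])
        next
          assume "A (2 * q + 1) j = 1"
          then show "wp Z (IfNZ 55 (Add 9 9 51) Skip) (wp Z (Times_Base 51) J) s3"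
            using s3 by (simp add: last[folded J_def])
        qed
      qed (use s2 reps_nth(1) s'(5) assms(5) in simp_all)
    qed (use s1 in simp_all)
    have A: "A (2 * q) j = (if q = j then 1 else 0)" by (simp add: A_def)
    show ?case
      unfolding R_def[symmetric] J_def[symmetric]
    proof (cases "q = j")
      case True
      then show "wp Z (Sub 55 53 50 ;; Sub 56 50 53 ;; Add 55 55 56 ;; IfNZ 55 Skip (Add 9 9 51) ;; R) J s'"
        using s' A by (simp add: rest)
    next
      case False
      then have "reps ! q \<noteq> reps ! j" using s'(5) assms(5) by (simp add: reps_eq_iff)
      then have "0 < reps ! q - reps ! j + (reps ! j - reps ! q)"
        by (auto simp: nat_neq_iff)
      then show "wp Z (Sub 55 53 50 ;; Sub 56 50 53 ;; Add 55 55 56 ;; IfNZ 55 Skip (Add 9 9 51) ;; R) J s'"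
        using s' A False by (simp add: rest)
    qed
  qed (use assms(1-3) in \<open>simp_all add: dp.col_def dp.enc_def\<close>)
  then show ?thesis by (rule wp_frame) (rule assms(6))
qed

lemma wp_Halve:
  assumes "fst s 0 = len" "fst s 3 = n" "fst s 5 = dp.base" "fst s 6 = dp.cells" "fst s 7 = 2 ^ i"
    "snd s = memory T"
    and "\<And>s'. snd s' = memory (dp.halve i (2 * p) T) \<Longrightarrow> frame Halve s s' \<Longrightarrow> Q s'"
  shows "wp Z Halve Q s"
proof -
  let ?I = "\<lambda>q s'. fst s' 8 = dp.base ^ (2 * q) \<and> snd s' = memory (dp.halve i (2 * q) T)"
  have base: "dp.base > 0" by (simp add: dp.base_def)
  have "wp Z Halve (\<lambda>s'. snd s' = memory (dp.halve i (2 * p) T)) s"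
    unfolding Halve_def wp.simps
  proof (rule wp_For_Reps[where I = ?I], goal_cases)
    case (9 q s')
    then have s': "fst s' 0 = len" "fst s' 3 = n" "fst s' 5 = dp.base" "fst s' 6 = dp.cells"
      "fst s' 7 = 2 ^ i" "fst s' 47 = reps ! q" "q < p"
      "fst s' 8 = dp.base ^ (2 * q)" "snd s' = memory (dp.halve i (2 * q) T)"
      using assms(1-5) by (simp_all add: frame_def)
    \<comment> \<open>One row of the halving stage; applied to row \<open>2 * q\<close> with
      register 22 and to row \<open>2 * q + 1\<close> with register 23.\<close>
    have row: "wp Z (Bit y ;; Halve_Row ;; Times_Base 8) R s1"
      if s1: "fst s1 0 = len" "fst s1 5 = dp.base" "fst s1 6 = dp.cells" "fst s1 7 = 2 ^ i"
        "fst s1 8 = dp.base ^ h" "snd s1 = memory (dp.halve i h T)" "fst s1 y = bnd h"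
        and y: "y = 22 \<or> y = 23"
        and R: "\<And>s'. fst s' 8 = dp.base ^ Suc h \<Longrightarrow> snd s' = memory (dp.halve i (Suc h) T) \<Longrightarrow>
          frame (Bit y ;; Halve_Row ;; Times_Base 8) s1 s' \<Longrightarrow> R s'"
      for s1 y h R
    proof -
      have "bnd h \<le> n" using class_size_le class_bound_le by (simp add: bnd_def)
      have "wp Z (Bit y ;; Halve_Row ;; Times_Base 8)
          (\<lambda>s'. fst s' 8 = dp.base ^ Suc h \<and> snd s' = memory (dp.halve i (Suc h) T)) s1"
        unfolding wp.simps(7)
      proof (rule wp_Bit[where i = i], goal_cases)
        case (4 s2)
        have s2: "fst s2 0 = len" "fst s2 5 = dp.base" "fst s2 6 = dp.cells" "fst s2 8 = dp.base ^ h"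
          "snd s2 = memory (dp.halve i h T)" "fst s2 28 = bnd h div 2 ^ i mod 2"
          using 4(1) s1 by (simp_all add: frame_reg[OF 4(2)] frame_mem[OF 4(2)])
        show ?case
        proof (rule wp_Halve_Row[OF s2(1-4) _ s2(6,5)], goal_cases)
          case (2 s3)
          have s3: "fst s3 5 = dp.base" "fst s3 8 = dp.base ^ h" "snd s3 = memory (dp.halve i (Suc h) T)"
            using 2(1) s2 by (simp_all add: frame_reg[OF 2(2)])
          show ?case
          proof (rule wp_Times_Base, goal_cases)
            case (3 s4)
            then show ?case using s3 by (simp add: frame_mem[OF 3(2)])
          qed (use s3 in simp_all)
        qed (use base in simp)
      qed (use s1 y \<open>bnd h \<le> n\<close> in auto)
      then show ?thesis by (rule wp_frame) (use R in blast)
    qed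
    show ?case
      unfolding wp.simps(7)
    proof (rule wp_Class_Data, goal_cases)
      case (4 s1)
      have bnd: "class_size (reps ! q) = bnd (2 * q)" "class_bound (reps ! q) = bnd (Suc (2 * q))"
        by (simp_all add: bnd_def)
      have s1: "fst s1 0 = len" "fst s1 5 = dp.base" "fst s1 6 = dp.cells"
        "fst s1 7 = 2 ^ i" "fst s1 8 = dp.base ^ (2 * q)" "snd s1 = memory (dp.halve i (2 * q) T)"
        "fst s1 22 = bnd (2 * q)" "fst s1 23 = bnd (Suc (2 * q))"
        using 4(1,2) s' bnd by (simp_all add: frame_reg[OF 4(3)] frame_mem[OF 4(3)])
      have "wp Z (Bit 22 ;; Halve_Row ;; Times_Base 8)
          (wp Z (Bit 23 ;; Halve_Row ;; Times_Base 8) (?I (Suc q))) s1"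
      proof (rule row[OF s1(1-7)], goal_cases)
        case (2 s2)
        have s2: "fst s2 0 = len" "fst s2 5 = dp.base" "fst s2 6 = dp.cells" "fst s2 7 = 2 ^ i"
          "fst s2 8 = dp.base ^ Suc (2 * q)" "snd s2 = memory (dp.halve i (Suc (2 * q)) T)"
          "fst s2 23 = bnd (Suc (2 * q))"
          using s1 2(1,2) by (simp_all add: frame_reg[OF 2(3)])
        show ?case
        proof (rule row[OF s2], goal_cases)
          case (2 s3)
          then show ?case by simp
        qed simp
      qed simp
      then show ?case unfolding wp.simps(7) .
    qed (use s' reps_nth(1) in simp_all)
  qed (use assms in simp_all)
  then show ?thesis by (rule wp_frame) (rule assms(7))
qed

lemma wp_Use_Vars:
  assumes "fst s 0 = len" "fst s 3 = n" "fst s 5 = dp.base" "fst s 6 = dp.cells" "snd s = memory T"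
    and "\<And>s'. snd s' = memory (dp.use_vars p T) \<Longrightarrow> frame Use_Vars s s' \<Longrightarrow> Q s'"
  shows "wp Z Use_Vars Q s"
proof -
  have "wp Z Use_Vars (\<lambda>s'. snd s' = memory (dp.use_vars p T)) s"
    unfolding Use_Vars_def
  proof (rule wp_For_Reps[where I = "\<lambda>q s'. snd s' = memory (dp.use_vars q T)"], goal_cases)
    case (9 q s')
    then have s': "fst s' 0 = len" "fst s' 3 = n" "fst s' 5 = dp.base" "fst s' 6 = dp.cells"
      "fst s' 50 = reps ! q" "q < p" "snd s' = memory (dp.use_vars q T)"
      using assms(1-4) by (simp_all add: frame_def)
    show ?case
      unfolding wp.simps(7)
    proof (rule wp_Column[OF s'(2,3) _ s'(5,6)], goal_cases)
      case (2 s1)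
      show ?case
        by (rule wp_Use_Var[where a = "dp.col q" and T = "dp.use_vars q T"])
          (use 2(1) s' in \<open>simp_all add: frame_reg[OF 2(2)] frame_mem[OF 2(2)]\<close>)
    qed (use s' in simp)
  qed (use assms(1-5) in simp_all)
  then show ?thesis by (rule wp_frame) (rule assms(6))
qed

lemma wp_Level:
  assumes "fst s 0 = len" "fst s 3 = n" "fst s 5 = dp.base" "fst s 6 = dp.cells" "fst s 7 = 2 ^ i"
    "snd s = memory T"
    and "\<And>s'. snd s' = memory (dp.level i T) \<Longrightarrow> Q s'"
  shows "wp Z Level Q s"
  unfolding Level_def wp.simps(7)
proof (rule wp_Halve[OF assms(1-6)], goal_cases)
  case (1 s1)
  have s1: "fst s1 0 = len" "fst s1 3 = n" "fst s1 5 = dp.base" "fst s1 6 = dp.cells"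
    using assms(1-4) by (simp_all add: frame_reg[OF 1(2)] Halve_def)
  show ?case
  proof (rule wp_Double[OF s1(1,4) 1(1)], goal_cases)
    case (1 s2)
    show ?case
      by (rule wp_Use_Vars[OF _ _ _ _ 1(1)])
        (use s1 assms(7) in \<open>simp_all add: frame_reg[OF 1(2)] dp.level_def\<close>)
  qed
qed

lemma wp_Count_Reps:
  assumes "fst s 3 = n" "input (snd s)"
    and "\<And>s'. fst s' 4 = p \<Longrightarrow> frame Count_Reps s s' \<Longrightarrow> Q s'"
  shows "wp Z Count_Reps Q s"
proof -
  have "wp Z Count_Reps (\<lambda>s'. fst s' 4 = p) s"
    unfolding Count_Reps_def wp.simps
  proof (rule wp_For[where I = "\<lambda>j s'. fst s' 4 = length (filter rep [0..<j])"], goal_cases)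
    case (11 j s')
    then have s': "fst s' 3 = n" "input (snd s')" "fst s' 65 = j" "j < n"
      using assms(1,2) by (simp_all add: frame_def)
    show ?case
      unfolding wp.simps(7)
    proof (rule wp_Is_Rep, goal_cases)
      case (6 s'')
      then show ?case using s' 11(2) by (simp add: frame_reg[OF 6(2)])
    qed (use s' in simp_all)
  qed (use assms(1) Z in \<open>simp_all add: p_def reps_def\<close>)
  then show ?thesis by (rule wp_frame) (rule assms(3))
qed

lemma wp_Setup:
  assumes "fst s 0 = len" "fst s 4 = p" "snd s = memory (\<lambda>_. 0)"
    and "\<And>s'. fst s' 5 = dp.base \<Longrightarrow> fst s' 6 = dp.cells \<Longrightarrow> snd s' = memory (dp.table 0) \<Longrightarrow>
      frame Setup s s' \<Longrightarrow> Q s'"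
  shows "wp Z Setup Q s"
proof -
  have eq: "(memory (\<lambda>_. 0))(len := Suc 0) = memory (dp.table 0)"
    using memory_upd[of "\<lambda>_. 0" 0 1] by simp
  have size: "dp.base = Suc (p + p)" "dp.cells = Suc (p + p) ^ (p + p)"
    unfolding dp.cells_def dp.base_def by (simp_all add: mult_2)
  have "wp Z Setup (\<lambda>s'. fst s' 5 = dp.base \<and> fst s' 6 = dp.cells \<and> snd s' = memory (dp.table 0)) s"
    unfolding Setup_def wp.simps
  proof (rule wp_Expt, goal_cases)
    case (6 s')
    then show ?case
      using assms(1-3) eq
      by (simp add: frame_reg[OF 6(2)] frame_mem[OF 6(2)] size del: dp.table.simps)
  qed (use assms(2) Z(3) in \<open>simp_all add: dp.base_def\<close>)
  then show ?thesis by (rule wp_frame) (use assms(4) in blast)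
qed

lemma wp_Fill:
  assumes "fst s 0 = len" "fst s 3 = n" "fst s 5 = dp.base" "fst s 6 = dp.cells"
    "snd s = memory (dp.table 0)"
    and "\<And>s'. snd s' = memory (dp.table n) \<Longrightarrow> frame Fill s s' \<Longrightarrow> Q s'"
  shows "wp Z Fill Q s"
proof -
  have "wp Z Fill (\<lambda>s'. snd s' = memory (dp.table n)) s"
    unfolding Fill_def
  proof (rule wp_For[where I = "\<lambda>k s'. snd s' = memory (dp.table k)"], goal_cases)
    case (11 k s')
    then have s': "fst s' 0 = len" "fst s' 3 = n" "fst s' 5 = dp.base" "fst s' 6 = dp.cells"
      "snd s' = memory (dp.table k)" "fst s' 74 = k" "k < n"
      using assms(1-4) by (simp_all add: frame_def Level_def Halve_def Use_Vars_def)
    show ?case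
      unfolding wp.simps
    proof (rule wp_Expt, goal_cases)
      case (6 s1)
      show ?case
        by (rule wp_Level[where i = "n - 1 - k" and T = "dp.table k"])
          (use 6(1) s' in \<open>simp_all add: frame_reg[OF 6(2)] frame_mem[OF 6(2)]\<close>)
    qed (use s' Z in simp_all)
  qed (use assms(2,5) Z in \<open>simp_all add: Level_def Halve_def Use_Vars_def\<close>)
  then show ?thesis by (rule wp_frame) (rule assms(6))
qed

lemma wp_Decide:
  assumes "fst s 0 = len" "snd s = memory T"
  shows "wp Z Decide (\<lambda>s'. result s' = (if target x < 0 \<or> nat \<bar>target x\<bar> < T 0 then 1 else 0)) s"
proof -
  have "memory T (Suc 0) = (if target x < 0 then 1 else 0)" "memory T 2 = nat \<bar>target x\<bar>"
    using input_nth[OF input_memory, of 1 T] input_nth[OF input_memory, of 2 T] encode_nth(2,3)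
    by simp_all
  then show ?thesis
    using assms unfolding Decide_def result_def by (simp add: less_Suc_eq_le)
qed

lemma wp_Solve:
  "wp Z Solve (\<lambda>s'. result s' = (if hs_yes x then 1 else 0)) (init (hs_encode x))"
proof -
  let ?s = "((fst (init (hs_encode x)))(3 := n), snd (init (hs_encode x)))"
  have mem: "snd (init (hs_encode x)) = memory (\<lambda>_. 0)"
    by (auto simp: init_def memory_def fun_eq_iff)
  have n: "memory (\<lambda>_. 0) 0 = n"
    using input_nth[OF input_memory, of 0] encode_nth(1) by simp
  have s: "fst ?s 0 = len" "fst ?s 3 = n" "snd ?s = memory (\<lambda>_. 0)"
    using mem by (simp_all add: init_def)
  have "wp Z (Count_Reps ;; Setup ;; Fill ;; Decide)
      (\<lambda>s'. result s' = (if hs_yes x then 1 else 0)) ?s"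
    unfolding wp.simps(7)
  proof (rule wp_Count_Reps, goal_cases)
    case (3 s1)
    have s1: "fst s1 0 = len" "fst s1 3 = n" "snd s1 = memory (\<lambda>_. 0)"
      using s by (simp_all add: frame_reg[OF 3(2)] frame_mem[OF 3(2)] Count_Reps_def)
    show ?case
    proof (rule wp_Setup[OF s1(1) 3(1) s1(3)], goal_cases)
      case (1 s2)
      have s2: "fst s2 0 = len" "fst s2 3 = n"
        using s1 by (simp_all add: frame_reg[OF 1(4)] Setup_def)
      show ?case
      proof (rule wp_Fill[OF s2 1(1-3)], goal_cases)
        case (1 s3)
        have "fst s3 0 = len"
          using s2 by (simp add: frame_reg[OF 1(2)] Fill_def Level_def Halve_def Use_Vars_def)
        then show ?case using wp_Decide[OF _ 1(1)] hs_yes_iff_table by simp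
      qed
    qed
  qed (use s in simp_all)
  then show ?thesis using mem n by (simp add: Solve_def init_def)
qed

end

section \<open>Running time and the computable parameter bound\<close>

definition width :: "nat \<Rightarrow> nat" where
  "width q = (2 * q + 1) ^ (2 * q) + (2 * q + 1) + 2"

text \<open>\<open>width q\<close> adds up table size, base and 2 for \<open>q\<close> classes.
  Monotonicity allows \<open>p\<close> to be replaced by its bound in terms of the vertex cover
  number.\<close>

lemma width_mono: "q \<le> r \<Longrightarrow> width q \<le> width r"
proof -
  assume "q \<le> r"
  have "(2 * q + 1) ^ (2 * q) \<le> (2 * r + 1) ^ (2 * q)" using \<open>q \<le> r\<close> by (intro power_mono) auto
  also have "\<dots> \<le> (2 * r + 1) ^ (2 * r)" using \<open>q \<le> r\<close> by (intro power_increasing) auto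
  finally show ?thesis using \<open>q \<le> r\<close> by (simp add: width_def)
qed

lemma (in harmless_instance) Solve_correct:
  "\<exists>t s. exec Solve (init (hs_encode x)) t s \<and>
     t \<le> cost_factor Solve * width (hs_vertex_cover_number x + 2 ^ hs_vertex_cover_number x) ^ loop_depth Solve
       * input_size (hs_encode x) ^ loop_depth Solve \<and>
     result s = (if hs_yes x then 1 else 0)"
proof -
  let ?k = "hs_vertex_cover_number x"
  define Z where "Z = n + width p"
  interpret harmless_machine x Z
    by standard (simp_all add: Z_def width_def dp.cells_def dp.base_def)
  obtain t s where ts: "exec Solve (init (hs_encode x)) t s"
    "t \<le> cost_factor Solve * Z ^ loop_depth Solve" "result s = (if hs_yes x then 1 else 0)"
    using wp_sound[OF wp_Solve] Z(4) by auto
  \<comment> \<open>Passing from a sum to a product separates the parameter from the input size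
    before taking powers.\<close>
  have "Z \<le> width p * (n + 1)"
    unfolding Z_def by (simp add: width_def)
  also have "\<dots> \<le> width (?k + 2 ^ ?k) * input_size (hs_encode x)"
    by (intro mult_mono width_mono p_le input_size_ge) auto
  finally have "Z ^ loop_depth Solve \<le>
      width (?k + 2 ^ ?k) ^ loop_depth Solve * input_size (hs_encode x) ^ loop_depth Solve"
    unfolding power_mult_distrib[symmetric] by (rule power_mono) simp
  then have "t \<le> cost_factor Solve * (width (?k + 2 ^ ?k) ^ loop_depth Solve
      * input_size (hs_encode x) ^ loop_depth Solve)"
    using ts(2) by (meson le_trans mult_le_mono2)
  then show ?thesis using ts(1,3) unfolding mult.assoc by blast
qed

text \<open>The bound is evaluated by an explicit program. Only termination matters here, so
  \<open>Z\<close> may be any number that exceeds all loop counts for the given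
  \<open>k\<close>.\<close>

lemma computable_bound: "computable (\<lambda>k. C * width (k + 2 ^ k) ^ d)"
proof -
  let ?W = "Const 3 0 ;; Load 3 3 ;; Const 4 2 ;; Expt 5 4 3 10 11 12 13 14 ;; Add 5 5 3 ;;
    Add 6 5 5 ;; Const 2 1 ;; Add 7 6 2 ;; Expt 8 7 6 10 11 12 13 14 ;; Add 8 8 7 ;; Const 9 2 ;;
    Add 8 8 9"
  let ?P = "?W ;; Const 15 d ;; Expt 16 8 15 10 11 12 13 14 ;; Const 17 C ;; Mul 0 16 17 10 11"
  have "\<exists>t s. exec ?P (init [k]) t s \<and> result s = C * width (k + 2 ^ k) ^ d" for k
  proof -
    define q where "q = k + 2 ^ k"
    define Z where "Z = k + (2 * q + 1) + width q + C + d + 2"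
    have "wp Z ?W (\<lambda>s. fst s 8 = width q) (init [k])"
      unfolding wp.simps
    proof (rule wp_Expt, goal_cases)
      case (6 s1)
      have s1: "fst s1 5 = 2 ^ k" "fst s1 3 = k"
        using 6(1) by (simp_all add: frame_reg[OF 6(2)] init_def)
      show ?case
      proof (rule wp_Expt, goal_cases)
        case (6 s2)
        have "fst s2 8 = (2 * q + 1) ^ (2 * q)" "fst s2 7 = 2 * q + 1"
          using 6(1) s1 by (simp_all add: frame_reg[OF 6(2)] q_def mult_2 add_ac)
        then show ?case by (simp add: width_def)
      qed (use s1 in \<open>simp_all add: Z_def q_def\<close>)
    qed (simp_all add: init_def Z_def)
    then have "wp Z ?P (\<lambda>s. result s = C * width q ^ d) (init [k])"
      unfolding wp.simps(7)[of _ ?W]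
    proof (rule wp_mono)
      fix s :: state assume s: "fst s 8 = width q"
      show "wp Z (Const 15 d ;; Expt 16 8 15 10 11 12 13 14 ;; Const 17 C ;; Mul 0 16 17 10 11)
          (\<lambda>s. result s = C * width q ^ d) s"
        unfolding wp.simps
      proof (rule wp_Expt, goal_cases)
        case (6 s1)
        show ?case
          by (rule wp_Mul) (use 6(1) s in \<open>simp_all add: result_def Z_def\<close>)
      qed (use s in \<open>simp_all add: Z_def\<close>)
    qed
    moreover have "1 \<le> Z" by (simp add: Z_def)
    ultimately show ?thesis unfolding q_def[symmetric] using wp_sound by blast
  qed
  then show ?thesis unfolding computable_def by blast
qed

theorem theorem3:
  shows "fixed_parameter_tractable hs_instances hs_encode hs_yes hs_vertex_cover_number"
  unfolding fixed_parameter_tractable_def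
  using computable_bound harmless_instance.Solve_correct[OF harmless_instance.intro] by blast
end
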